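(* Let $\mathfrak{a}$ be a finite-dimensional complex Lie algebra with commuting ad-semisimple elements $X,Y\in\mathfrak{a}$ having integer ad-eigenvalues, and let $\mathfrak{a}_{ij}=\{Z\in\mathfrak{a}:[X,Z]=iZ,[Y,Z]=jZ\}$. Assume that $\mathfrak{a}_{ij}=\{0\}$ if $j\notin\{-1,0,1\}$ and that $\mathfrak{a}_{1,-1}=\{0\}$. Let $\xi\in\mathcal{N}_1^*$ be such that $\xi|_{\mathcal{N}_2}=0$ and $\xi|_{\mathfrak{a}_{ij}}=0$ unless $i=1,j=0$. Let $M$ be an $\mathfrak{a}$-module with a (not necessarily good) filtration $F^iM$, let $L$ be the $\xi$-coinvariants module of $M$ and $F^iL$ the induced filtration on $L$. Suppose $\phi\in Res[AV_F(L)]\subset(\mathfrak{a}_{0,1})^*$ and regard $\phi+\xi$ as an element of $\mathfrak{a}^*$ via $$(\phi+\xi)|_{\mathfrak{a}_{0,1}}=\phi,\quad(\phi+\xi)|_{\mathfrak{a}_{1,0}}=\xi,\quad(\phi+\xi)|_{\mathfrak{a}_{ij}}=0\text{ for all other pairs }(i,j).$$ Then $\phi+\xi\in\mathcal{V}(M)$.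
   Context: $\mathfrak{a}_i=\bigoplus_j\mathfrak{a}_{ij}$, so $\mathfrak{a}=\bigoplus_i\mathfrak{a}_i$. For $s\ge0$, $\mathcal{N}_s=\bigoplus_{i\ge s}\mathfrak{a}_i$; $\mathcal{N}_0$ is a Lie subalgebra and $\mathcal{N}_1$ is a nilpotent ideal of it. Since $\xi|_{\mathcal{N}_2}=0$, $\xi$ is a Lie algebra character of $\mathcal{N}_1$. $\mathcal{N}_0^\xi$ and $\mathfrak{a}_0^\xi$ denote the stabilizers of $\xi$ in $\mathcal{N}_0$ and $\mathfrak{a}_0$ (i.e. elements $Z$ with $\xi([Z,W])=0$ for all $W\in\mathcal{N}_1$); $\mathcal{N}_0^\xi=\mathfrak{a}_0^\xi\oplus\mathcal{N}_1$. Under the stated assumptions $\mathfrak{a}_{0,1}\subset\mathfrak{a}_0^\xi$, so there is a restriction map $Res:(\mathfrak{a}_0^\xi)^*\to(\mathfrak{a}_{0,1})^*$. The $\xi$-coinvariants module is $L=M/M'$ with $M'=\mathrm{span}\{Zv-\xi(Z)v: Z\in\mathcal{N}_1,v\in M\}$; it is an $\mathfrak{a}_0^\xi$-module. Filtrations: the enveloping algebra $U(\mathfrak{a})$ has its standard filtration $U^i$ by order, with associated graded algebra $\mathrm{Sym}(\mathfrak{a})$. A filtration of a module $M$ is a presentation as an ascending union of vector spaces $M=\bigcup_{i\ge0}F^iM$ with $U^i F^jM\subset F^{i+j}M$. The induced filtration on $L$ is the image of $F^iM$. $\mathrm{Gr}_F(L)=\bigoplus_i F^iL/F^{i-1}L$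 (with $F^{-1}L=0$) is a $\mathrm{Sym}(\mathfrak{a}_0^\xi)$-module and $AV_F(L)\subset(\mathfrak{a}_0^\xi)^*$ is its support, i.e. the zero set of its annihilator in $\mathrm{Sym}(\mathfrak{a}_0^\xi)$. Annihilator variety: $\mathcal{V}(M)\subset\mathfrak{a}^*$ is the zero set of the ideal of $\mathrm{Sym}(\mathfrak{a})$ generated by the symbols of elements of the annihilator of $M$ in $U(\mathfrak{a})$. *)

theory Defs
  imports Complex_Main "HOL-Algebra.QuotRing" "HOL-Algebra.Module" "HOL-Library.Poly_Mapping"
begin

section \<open>Lie algebras, weight spaces and dual spaces\<close>

text \<open>A Lie algebra lives on a whole type; its subspaces and subalgebras are sets.\<close>

locale complex_lie_algebra = vector_space sc
  for sc :: "complex \<Rightarrow> 'a::ab_group_add \<Rightarrow> 'a" +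
  fixes br :: "'a \<Rightarrow> 'a \<Rightarrow> 'a"
  assumes bracket_linear_left: "Vector_Spaces.linear sc sc (\<lambda>x. br x y)"
    and bracket_linear_right: "Vector_Spaces.linear sc sc (br x)"
    and bracket_self: "br x x = 0"
    and jacobi: "br x (br y z) + br y (br z x) + br z (br x y) = 0"
    and finite_dim: "\<exists>B. finite B \<and> span B = UNIV"

text \<open>Over the complex numbers and in finite dimension, a semisimple endomorphism is one whose
  eigenvectors span the space.\<close>

definition ad_semisimple :: "(complex \<Rightarrow> 'a::ab_group_add \<Rightarrow> 'a) \<Rightarrow> ('a \<Rightarrow> 'a \<Rightarrow> 'a) \<Rightarrow> 'a \<Rightarrow> bool"
  where "ad_semisimple sc br X \<longleftrightarrow> module.span sc {Z. \<exists>c. br X Z = sc c Z} = UNIV"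

definition integer_ad_eigenvalues ::
    "(complex \<Rightarrow> 'a::ab_group_add \<Rightarrow> 'a) \<Rightarrow> ('a \<Rightarrow> 'a \<Rightarrow> 'a) \<Rightarrow> 'a \<Rightarrow> bool"
  where "integer_ad_eigenvalues sc br X \<longleftrightarrow> (\<forall>c Z. Z \<noteq> 0 \<and> br X Z = sc c Z \<longrightarrow> c \<in> \<int>)"

definition weight_space ::
    "(complex \<Rightarrow> 'a::ab_group_add \<Rightarrow> 'a) \<Rightarrow> ('a \<Rightarrow> 'a \<Rightarrow> 'a) \<Rightarrow> 'a \<Rightarrow> 'a \<Rightarrow> int \<Rightarrow> int \<Rightarrow> 'a set"
  where "weight_space sc br X Y i j = {Z. br X Z = sc (of_int i) Z \<and> br Y Z = sc (of_int j) Z}"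

definition graded_part ::
    "(complex \<Rightarrow> 'a::ab_group_add \<Rightarrow> 'a) \<Rightarrow> ('a \<Rightarrow> 'a \<Rightarrow> 'a) \<Rightarrow> 'a \<Rightarrow> 'a \<Rightarrow> int \<Rightarrow> 'a set"
  where "graded_part sc br X Y i = module.span sc (\<Union>j. weight_space sc br X Y i j)"

definition upper_part ::
    "(complex \<Rightarrow> 'a::ab_group_add \<Rightarrow> 'a) \<Rightarrow> ('a \<Rightarrow> 'a \<Rightarrow> 'a) \<Rightarrow> 'a \<Rightarrow> 'a \<Rightarrow> int \<Rightarrow> 'a set"
  where "upper_part sc br X Y s = module.span sc (\<Union>i\<in>{s..}. graded_part sc br X Y i)"

definition stabilizer0 ::
    "(complex \<Rightarrow> 'a::ab_group_add \<Rightarrow> 'a) \<Rightarrow> ('a \<Rightarrow> 'a \<Rightarrow> 'a) \<Rightarrow> 'a \<Rightarrow> 'a \<Rightarrow> ('a \<Rightarrow> complex) \<Rightarrow> 'a set"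
  where "stabilizer0 sc br X Y \<xi> =
    {Z \<in> graded_part sc br X Y 0. \<forall>W\<in>upper_part sc br X Y 1. \<xi> (br Z W) = 0}"

text \<open>The dual of a subspace \<open>S\<close>. Functionals are extensional, so that restricting from \<open>S\<close> to a
  smaller subspace is \<^const>\<open>restrict\<close>.\<close>

definition dual_space :: "(complex \<Rightarrow> 'a::ab_group_add \<Rightarrow> 'a) \<Rightarrow> 'a set \<Rightarrow> ('a \<Rightarrow> complex) set"
  where "dual_space sc S = {f \<in> extensional S.
    (\<forall>x\<in>S. \<forall>y\<in>S. f (x + y) = f x + f y) \<and> (\<forall>c. \<forall>x\<in>S. f (sc c x) = c * f x)}"

text \<open>The functional \<open>\<phi> + \<xi>\<close> on the whole Lie algebra; it exists and is unique when the Lie algebra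
  is the direct sum of its weight spaces.\<close>

definition glued_functional ::
    "(complex \<Rightarrow> 'a::ab_group_add \<Rightarrow> 'a) \<Rightarrow> ('a \<Rightarrow> 'a \<Rightarrow> 'a) \<Rightarrow> 'a \<Rightarrow> 'a
      \<Rightarrow> ('a \<Rightarrow> complex) \<Rightarrow> ('a \<Rightarrow> complex) \<Rightarrow> 'a \<Rightarrow> complex"
  where "glued_functional sc br X Y \<phi> \<xi> = (THE f. f \<in> dual_space sc UNIV \<and>
    (\<forall>Z\<in>weight_space sc br X Y 0 1. f Z = \<phi> Z) \<and>
    (\<forall>Z\<in>weight_space sc br X Y 1 0. f Z = \<xi> Z) \<and>
    (\<forall>i j. (i, j) \<notin> {(0, 1), (1, 0)} \<longrightarrow> (\<forall>Z\<in>weight_space sc br X Y i j. f Z = 0)))"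


section \<open>Free algebras, enveloping algebras and symmetric algebras\<close>

datatype 'a fword = Word (letters: "'a list")

instantiation fword :: (type) monoid_add
begin

definition "0 = Word []"

definition "u + v = Word (letters u @ letters v)"

instance
  by standard (simp_all add: zero_fword_def plus_fword_def)

end

text \<open>The free associative complex algebra on the elements of a type; multiplication of polynomial
  mappings is convolution, so it concatenates words.\<close>

type_synonym 'a free_algebra = "'a fword \<Rightarrow>\<^sub>0 complex"

abbreviation gen :: "'a \<Rightarrow> 'a free_algebra"
  where "gen x \<equiv> Poly_Mapping.single (Word [x]) 1"

definition free_ring :: "'a set \<Rightarrow> 'a free_algebra ring"
  where "free_ring g = \<lparr>carrier = {p. \<forall>w\<in>Poly_Mapping.keys p. set (letters w) \<subseteq> g},
    mult = (*), one = 1, zero = 0, add = (+)\<rparr>"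

lemma free_ring_is_ring: "ring (free_ring g)"
proof (rule ringI)
  have keys_mult: "set (letters w) \<subseteq> g"
    if "w \<in> Poly_Mapping.keys (p * q)" "\<forall>w\<in>Poly_Mapping.keys p. set (letters w) \<subseteq> g"
      "\<forall>w\<in>Poly_Mapping.keys q. set (letters w) \<subseteq> g" for p q :: "'a free_algebra" and w
    using that keys_mult[of p q] by (fastforce simp: plus_fword_def)
  show "abelian_group (free_ring g)"
  proof (rule abelian_groupI)
    fix p assume p: "p \<in> carrier (free_ring g)"
    show "\<exists>q\<in>carrier (free_ring g). q \<oplus>\<^bsub>free_ring g\<^esub> p = \<zero>\<^bsub>free_ring g\<^esub>"
      by (rule bexI[of _ "- p"]) (use p in \<open>auto simp: free_ring_def\<close>)
  qed (use Poly_Mapping.keys_add in \<open>fastforce simp: free_ring_def algebra_simps\<close>)+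
  show "Group.monoid (free_ring g)"
    by unfold_locales
      (auto simp: free_ring_def zero_fword_def mult.assoc dest: keys_mult[THEN subsetD])
qed (auto simp: free_ring_def algebra_simps)

text \<open>Dividing the free algebra on the set \<open>g\<close> by these relations yields the tensor algebra of the
  vector space \<open>g\<close>.\<close>

definition linear_rels ::
    "(complex \<Rightarrow> 'a::ab_group_add \<Rightarrow> 'a) \<Rightarrow> 'a set \<Rightarrow> 'a free_algebra set"
  where "linear_rels sc g =
    {gen (x + y) - gen x - gen y | x y. x \<in> g \<and> y \<in> g} \<union>
    {gen (sc c x) - Poly_Mapping.single (Word [x]) c | c x. x \<in> g}"

definition sym_ideal ::
    "(complex \<Rightarrow> 'a::ab_group_add \<Rightarrow> 'a) \<Rightarrow> 'a set \<Rightarrow> 'a free_algebra set"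
  where "sym_ideal sc g = Idl\<^bsub>free_ring g\<^esub>
    (linear_rels sc g \<union> {gen x * gen y - gen y * gen x | x y. x \<in> g \<and> y \<in> g})"

definition Sym ::
    "(complex \<Rightarrow> 'a::ab_group_add \<Rightarrow> 'a) \<Rightarrow> 'a set \<Rightarrow> 'a free_algebra set ring"
  where "Sym sc g = free_ring g Quot sym_ideal sc g"

definition sym_class ::
    "(complex \<Rightarrow> 'a::ab_group_add \<Rightarrow> 'a) \<Rightarrow> 'a set \<Rightarrow> 'a free_algebra \<Rightarrow> 'a free_algebra set"
  where "sym_class sc g p = sym_ideal sc g +>\<^bsub>free_ring g\<^esub> p"

text \<open>Evaluation at \<open>f\<close> is constant on the cosets that make up the symmetric algebra whenever \<open>f\<close> is in
  the dual of \<open>g\<close>. Here and below, \<^const>\<open>the_elem\<close> of an image under a map that is constant on a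
  coset is the value induced on the quotient.\<close>

definition free_eval :: "('a \<Rightarrow> complex) \<Rightarrow> 'a free_algebra \<Rightarrow> complex"
  where "free_eval f p =
    (\<Sum>w\<in>Poly_Mapping.keys p. Poly_Mapping.lookup p w * prod_list (map f (letters w)))"

definition sym_eval :: "('a \<Rightarrow> complex) \<Rightarrow> 'a free_algebra set \<Rightarrow> complex"
  where "sym_eval f s = the_elem (free_eval f ` s)"

definition zero_set ::
    "(complex \<Rightarrow> 'a::ab_group_add \<Rightarrow> 'a) \<Rightarrow> 'a set \<Rightarrow> 'a free_algebra set set \<Rightarrow> ('a \<Rightarrow> complex) set"
  where "zero_set sc g J = {f \<in> dual_space sc g. \<forall>s\<in>J. sym_eval f s = 0}"

definition env_ideal ::
    "(complex \<Rightarrow> 'a::ab_group_add \<Rightarrow> 'a) \<Rightarrow> ('a \<Rightarrow> 'a \<Rightarrow> 'a) \<Rightarrow> 'a free_algebra set"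
  where "env_ideal sc br = Idl\<^bsub>free_ring UNIV\<^esub>
    (linear_rels sc UNIV \<union> {gen x * gen y - gen y * gen x - gen (br x y) | x y. True})"

definition Env ::
    "(complex \<Rightarrow> 'a::ab_group_add \<Rightarrow> 'a) \<Rightarrow> ('a \<Rightarrow> 'a \<Rightarrow> 'a) \<Rightarrow> 'a free_algebra set ring"
  where "Env sc br = free_ring UNIV Quot env_ideal sc br"

definition env_class ::
    "(complex \<Rightarrow> 'a::ab_group_add \<Rightarrow> 'a) \<Rightarrow> ('a \<Rightarrow> 'a \<Rightarrow> 'a) \<Rightarrow> 'a free_algebra \<Rightarrow> 'a free_algebra set"
  where "env_class sc br p = env_ideal sc br +>\<^bsub>free_ring UNIV\<^esub> p"

definition env_filtration ::
    "(complex \<Rightarrow> 'a::ab_group_add \<Rightarrow> 'a) \<Rightarrow> ('a \<Rightarrow> 'a \<Rightarrow> 'a) \<Rightarrow> nat \<Rightarrow> 'a free_algebra set set"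
  where "env_filtration sc br i =
    env_class sc br ` {p. \<forall>w\<in>Poly_Mapping.keys p. length (letters w) \<le> i}"

text \<open>The step of index \<open>i - 1\<close> of a filtration, with the convention that the step of index \<open>-1\<close> is zero.\<close>

definition prev_step :: "'v \<Rightarrow> (nat \<Rightarrow> 'v set) \<Rightarrow> nat \<Rightarrow> 'v set"
  where "prev_step z G i = (case i of 0 \<Rightarrow> {z} | Suc j \<Rightarrow> G j)"

text \<open>\<open>s\<close> is the symbol of \<open>u\<close>: if \<open>u\<close> has order \<open>k\<close> and agrees, modulo order less than \<open>k\<close>, with the
  class of a homogeneous tensor \<open>t\<close> of degree \<open>k\<close>, then \<open>s\<close> is the image of \<open>t\<close> in the symmetric
  algebra. This is the identification of the associated graded algebra with the symmetric algebra;
  by the Poincare-Birkhoff-Witt theorem each \<open>u\<close> has exactly one symbol.\<close>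

definition is_symbol ::
    "(complex \<Rightarrow> 'a::ab_group_add \<Rightarrow> 'a) \<Rightarrow> ('a \<Rightarrow> 'a \<Rightarrow> 'a)
      \<Rightarrow> 'a free_algebra set \<Rightarrow> 'a free_algebra set \<Rightarrow> bool"
  where "is_symbol sc br u s \<longleftrightarrow> (\<exists>k t.
    u \<in> env_filtration sc br k \<and> (\<forall>l<k. u \<notin> env_filtration sc br l) \<and>
    (\<forall>w\<in>Poly_Mapping.keys t. length (letters w) = k) \<and>
    u \<ominus>\<^bsub>Env sc br\<^esub> env_class sc br t
      \<in> prev_step \<zero>\<^bsub>Env sc br\<^esub> (env_filtration sc br) k \<and>
    s = sym_class sc UNIV t)"


section \<open>Modules, quotients and filtrations\<close>

text \<open>Quotients of modules are again modules in the sense of \<^const>\<open>smult\<close> records; the ring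
  multiplication and unit in such a record play no role and are left unspecified.\<close>

definition space_of :: "(complex \<Rightarrow> 'v::ab_group_add \<Rightarrow> 'v) \<Rightarrow> (complex, 'v) module"
  where "space_of scV = \<lparr>carrier = UNIV, mult = undefined, one = undefined,
    zero = 0, add = (+), smult = scV\<rparr>"

definition quotient_map :: "('r, 'v) module \<Rightarrow> 'v set \<Rightarrow> ('v \<Rightarrow> 'v) \<Rightarrow> 'v set \<Rightarrow> 'v set"
  where "quotient_map V W f A = the_elem ((\<lambda>v. W +>\<^bsub>V\<^esub> f v) ` A)"

definition quotient_space :: "('r, 'v) module \<Rightarrow> 'v set \<Rightarrow> ('r, 'v set) module"
  where "quotient_space V W = \<lparr>carrier = a_rcosets\<^bsub>V\<^esub> W, mult = undefined, one = undefined,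
    zero = W, add = (<+>\<^bsub>V\<^esub>), smult = (\<lambda>c. quotient_map V W (\<lambda>v. c \<odot>\<^bsub>V\<^esub> v))\<rparr>"

definition free_act ::
    "(complex, 'v) module \<Rightarrow> ('a \<Rightarrow> 'v \<Rightarrow> 'v) \<Rightarrow> 'a free_algebra \<Rightarrow> 'v \<Rightarrow> 'v"
  where "free_act V \<rho> p v =
    (\<Oplus>\<^bsub>V\<^esub>w\<in>Poly_Mapping.keys p. Poly_Mapping.lookup p w \<odot>\<^bsub>V\<^esub> foldr \<rho> (letters w) v)"

locale lie_module =
  complex_lie_algebra sc br + M: vector_space scM
  for sc :: "complex \<Rightarrow> 'a::ab_group_add \<Rightarrow> 'a" and br :: "'a \<Rightarrow> 'a \<Rightarrow> 'a"
    and scM :: "complex \<Rightarrow> 'm::ab_group_add \<Rightarrow> 'm" +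
  fixes \<rho> :: "'a \<Rightarrow> 'm \<Rightarrow> 'm"
  assumes action_linear_left: "Vector_Spaces.linear sc scM (\<lambda>Z. \<rho> Z v)"
    and action_linear_right: "Vector_Spaces.linear scM scM (\<rho> Z)"
    and action_bracket: "\<rho> (br Z W) v = \<rho> Z (\<rho> W v) - \<rho> W (\<rho> Z v)"

definition env_act ::
    "(complex \<Rightarrow> 'm::ab_group_add \<Rightarrow> 'm) \<Rightarrow> ('a \<Rightarrow> 'm \<Rightarrow> 'm) \<Rightarrow> 'a free_algebra set \<Rightarrow> 'm \<Rightarrow> 'm"
  where "env_act scM \<rho> u v = the_elem ((\<lambda>p. free_act (space_of scM) \<rho> p v) ` u)"

definition annihilator_variety ::
    "(complex \<Rightarrow> 'a::ab_group_add \<Rightarrow> 'a) \<Rightarrow> ('a \<Rightarrow> 'a \<Rightarrow> 'a)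
      \<Rightarrow> (complex \<Rightarrow> 'm::ab_group_add \<Rightarrow> 'm) \<Rightarrow> ('a \<Rightarrow> 'm \<Rightarrow> 'm) \<Rightarrow> ('a \<Rightarrow> complex) set"
  where "annihilator_variety sc br scM \<rho> = zero_set sc UNIV (Idl\<^bsub>Sym sc UNIV\<^esub>
    {s. \<exists>u\<in>carrier (Env sc br). (\<forall>v. env_act scM \<rho> u v = 0) \<and> is_symbol sc br u s})"

definition module_filtration ::
    "(complex \<Rightarrow> 'a::ab_group_add \<Rightarrow> 'a) \<Rightarrow> ('a \<Rightarrow> 'a \<Rightarrow> 'a)
      \<Rightarrow> (complex \<Rightarrow> 'm::ab_group_add \<Rightarrow> 'm) \<Rightarrow> ('a \<Rightarrow> 'm \<Rightarrow> 'm) \<Rightarrow> (nat \<Rightarrow> 'm set) \<Rightarrow> bool"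
  where "module_filtration sc br scM \<rho> F \<longleftrightarrow>
    (\<forall>i. module.subspace scM (F i)) \<and> (\<forall>i. F i \<subseteq> F (Suc i)) \<and> (\<Union>i. F i) = UNIV \<and>
    (\<forall>i j. \<forall>u\<in>env_filtration sc br i. \<forall>v\<in>F j. env_act scM \<rho> u v \<in> F (i + j))"


section \<open>The associated graded module and its support\<close>

definition gr_piece :: "('r, 'v) module \<Rightarrow> (nat \<Rightarrow> 'v set) \<Rightarrow> nat \<Rightarrow> ('r, 'v set) module"
  where "gr_piece V G i = quotient_space (V\<lparr>carrier := G i\<rparr>) (prev_step \<zero>\<^bsub>V\<^esub> G i)"

definition gr_space :: "('r, 'v) module \<Rightarrow> (nat \<Rightarrow> 'v set) \<Rightarrow> ('r, nat \<Rightarrow> 'v set) module"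
  where "gr_space V G = \<lparr>
    carrier = {x. (\<forall>i. x i \<in> carrier (gr_piece V G i)) \<and> finite {i. x i \<noteq> \<zero>\<^bsub>gr_piece V G i\<^esub>}},
    mult = undefined, one = undefined,
    zero = (\<lambda>i. \<zero>\<^bsub>gr_piece V G i\<^esub>),
    add = (\<lambda>x y i. x i \<oplus>\<^bsub>gr_piece V G i\<^esub> y i),
    smult = (\<lambda>c x i. c \<odot>\<^bsub>gr_piece V G i\<^esub> x i)\<rparr>"

text \<open>A Lie algebra element sends step \<open>j\<close> of the filtration to step \<open>j + 1\<close>, so it acts on the graded
  space with degree one.\<close>

definition gr_act ::
    "('r, 'v) module \<Rightarrow> (nat \<Rightarrow> 'v set) \<Rightarrow> ('a \<Rightarrow> 'v \<Rightarrow> 'v) \<Rightarrow> 'a \<Rightarrow> (nat \<Rightarrow> 'v set) \<Rightarrow> nat \<Rightarrow> 'v set"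
  where "gr_act V G \<sigma> Z x i =
    (case i of 0 \<Rightarrow> \<zero>\<^bsub>gr_piece V G 0\<^esub> | Suc j \<Rightarrow> quotient_map V (G j) (\<sigma> Z) (x j))"

definition gr_module ::
    "(complex, 'v) module \<Rightarrow> (nat \<Rightarrow> 'v set) \<Rightarrow> ('a \<Rightarrow> 'v \<Rightarrow> 'v)
      \<Rightarrow> ('a free_algebra set, nat \<Rightarrow> 'v set) module"
  where "gr_module V G \<sigma> = \<lparr>carrier = carrier (gr_space V G), mult = undefined, one = undefined,
    zero = zero (gr_space V G), add = add (gr_space V G),
    smult = (\<lambda>s x. the_elem ((\<lambda>p. free_act (gr_space V G) (gr_act V G \<sigma>) p x) ` s))\<rparr>"

definition annihilator :: "'r ring \<Rightarrow> ('r, 'v) module \<Rightarrow> 'r set"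
  where "annihilator R N = {r \<in> carrier R. \<forall>x\<in>carrier N. r \<odot>\<^bsub>N\<^esub> x = \<zero>\<^bsub>N\<^esub>}"

definition associated_variety ::
    "(complex \<Rightarrow> 'a::ab_group_add \<Rightarrow> 'a) \<Rightarrow> 'a set \<Rightarrow> (complex, 'v) module \<Rightarrow> (nat \<Rightarrow> 'v set)
      \<Rightarrow> ('a \<Rightarrow> 'v \<Rightarrow> 'v) \<Rightarrow> ('a \<Rightarrow> complex) set"
  where "associated_variety sc g V G \<sigma> =
    zero_set sc g (annihilator (Sym sc g) (gr_module V G \<sigma>))"


section \<open>Coinvariants\<close>

definition coinv_kernel ::
    "(complex \<Rightarrow> 'm::ab_group_add \<Rightarrow> 'm) \<Rightarrow> ('a \<Rightarrow> 'm \<Rightarrow> 'm) \<Rightarrow> 'a set \<Rightarrow> ('a \<Rightarrow> complex) \<Rightarrow> 'm set"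
  where "coinv_kernel scM \<rho> n \<xi> = module.span scM {\<rho> Z v - scM (\<xi> Z) v | Z v. Z \<in> n}"

definition coinvariants ::
    "(complex \<Rightarrow> 'm::ab_group_add \<Rightarrow> 'm) \<Rightarrow> ('a \<Rightarrow> 'm \<Rightarrow> 'm) \<Rightarrow> 'a set \<Rightarrow> ('a \<Rightarrow> complex)
      \<Rightarrow> (complex, 'm set) module"
  where "coinvariants scM \<rho> n \<xi> = quotient_space (space_of scM) (coinv_kernel scM \<rho> n \<xi>)"

definition coinv_act ::
    "(complex \<Rightarrow> 'm::ab_group_add \<Rightarrow> 'm) \<Rightarrow> ('a \<Rightarrow> 'm \<Rightarrow> 'm) \<Rightarrow> 'a set \<Rightarrow> ('a \<Rightarrow> complex)
      \<Rightarrow> 'a \<Rightarrow> 'm set \<Rightarrow> 'm set"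
  where "coinv_act scM \<rho> n \<xi> Z = quotient_map (space_of scM) (coinv_kernel scM \<rho> n \<xi>) (\<rho> Z)"

definition coinv_filtration ::
    "(complex \<Rightarrow> 'm::ab_group_add \<Rightarrow> 'm) \<Rightarrow> ('a \<Rightarrow> 'm \<Rightarrow> 'm) \<Rightarrow> 'a set \<Rightarrow> ('a \<Rightarrow> complex)
      \<Rightarrow> (nat \<Rightarrow> 'm set) \<Rightarrow> nat \<Rightarrow> 'm set set"
  where "coinv_filtration scM \<rho> n \<xi> F i =
    (\<lambda>v. coinv_kernel scM \<rho> n \<xi> +>\<^bsub>space_of scM\<^esub> v) ` F i"

end

theory Submission
  imports Defs "HOL-Library.Function_Algebras"
begin

text \<open>Let \<open>u\<close> annihilate \<open>M\<close> and have order \<open>k\<close>. Its symbol has to be evaluated at a functional that lives on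
  the weights \<open>(0,1)\<close> and \<open>(1,0)\<close> only. So a monomial of the symbol matters only if all its \<open>k\<close> letters have
  these weights; if \<open>p\<close> of them have weight \<open>(0,1)\<close>, then the monomial has total weight \<open>(k - p, p)\<close>. As the
  annihilator is stable under \<open>ad X\<close> and \<open>ad Y\<close>, the component of \<open>u\<close> of that weight also annihilates \<open>M\<close>
  (\<open>weight_component\<close>), so each \<open>p\<close> can be treated separately.

  The key is to watch how such a component acts on the coinvariants \<open>M/M'\<close>. Give a letter of weight
  \<open>(i,j)\<close> the excess \<open>i + j - 1\<close>. The words of the component have length at most \<open>k\<close> and weight \<open>(k - p, p)\<close>,
  hence nonnegative total excess, with equality exactly for the words of full length \<open>k\<close>. Move every
  letter with \<open>i \<ge> 1\<close> to the front; there it acts modulo \<open>M'\<close> by the scalar \<open>\<xi>\<close>, which is zero unless the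
  weight is \<open>(1,0)\<close>, the case of excess zero. The commutators that arise are shorter words of the same
  weight, so their excess is positive. In the end only letters with \<open>i \<le> 0\<close> are left; as \<open>j \<le> 1\<close> for
  every weight, their excess is at most zero, and zero only for the weight \<open>(0,1)\<close>. Therefore a word acts modulo \<open>M'\<close> as
  the product of the values of \<open>\<xi>\<close> on its \<open>(1,0)\<close> letters times the product of its \<open>(0,1)\<close> letters, provided
  that there are no other letters, and as zero otherwise (\<open>word_mod_kernel\<close>).

  Thus the component of weight \<open>(k - p, p)\<close> acts on the coinvariants as a polynomial \<open>P\<close>, homogeneous of
  degree \<open>p\<close>, in elements of weight \<open>(0,1)\<close>, obtained from the leading term of \<open>u\<close> by putting \<open>\<xi>\<close> for the
  \<open>(1,0)\<close> letters. Since \<open>u\<close> acts as zero, so does \<open>P\<close>, and because \<open>P\<close> is homogeneous its class in the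
  symmetric algebra annihilates the associated graded module for whatever filtration
  (\<open>homogeneous_in_annihilator\<close>). So \<open>P\<close> vanishes at every point \<open>\<psi>\<close> of the associated variety. But the value
  of \<open>P\<close> at \<open>\<psi>\<close> is the value at \<open>\<phi> + \<xi>\<close> of the part of the symbol of weight \<open>(k - p, p)\<close>, where \<open>\<phi>\<close> is the
  restriction of \<open>\<psi>\<close>; summing over \<open>p\<close> gives the claim.

  All computations take place in the free algebra on the Lie algebra: a polynomial is expanded over
  words in a basis of joint weight vectors, and the actions that occur are checked to respect the
  relations of the enveloping and the symmetric algebra. An element of order \<open>k\<close> enters through a
  representative \<open>t + r\<close> with \<open>t\<close> homogeneous of degree \<open>k\<close>, giving the symbol, and \<open>r\<close> of smaller degree.\<close>

section \<open>Free algebras acting on vector spaces\<close>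

lemma poly_mapping_single_induct [case_names single add]:
  assumes single: "\<And>k c. P (Poly_Mapping.single k c)"
    and add: "\<And>p q. P p \<Longrightarrow> P q \<Longrightarrow> P (p + q)"
  shows "P (p :: 'k \<Rightarrow>\<^sub>0 'b::comm_monoid_add)"
proof -
  have "P (\<Sum>k\<in>A. Poly_Mapping.single k (Poly_Mapping.lookup p k))" if "finite A" for A
    using that
  proof (induction A)
    case empty
    then show ?case using single[of undefined 0] by simp
  next
    case (insert k A)
    then show ?case using single add by simp
  qed
  moreover have "p = (\<Sum>k\<in>Poly_Mapping.keys p. Poly_Mapping.single k (Poly_Mapping.lookup p k))"
    by (rule poly_mapping_eqI)
      (simp add: lookup_sum lookup_single when_def in_keys_iff if_distrib cong: if_cong)
  ultimately show ?thesis by (metis finite_keys)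
qed

text \<open>The linear extension of composing operators along words. It is \<^const>\<open>free_act\<close> without the
  record structure on the module, so that its algebra can be done with type class operations;
  evaluation at a functional is the case of operators that are scalars.\<close>

definition poly_act ::
    "(complex \<Rightarrow> 'v::ab_group_add \<Rightarrow> 'v) \<Rightarrow> ('a \<Rightarrow> 'v \<Rightarrow> 'v) \<Rightarrow> 'a free_algebra \<Rightarrow> 'v \<Rightarrow> 'v"
  where "poly_act scV \<tau> p v =
    (\<Sum>w\<in>Poly_Mapping.keys p. scV (Poly_Mapping.lookup p w) (foldr \<tau> (letters w) v))"

locale operator_family = vector_space scV
  for scV :: "complex \<Rightarrow> 'v::ab_group_add \<Rightarrow> 'v" +
  fixes \<tau> :: "'a \<Rightarrow> 'v \<Rightarrow> 'v"
  assumes op_add: "\<tau> Z (u + v) = \<tau> Z u + \<tau> Z v"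
    and op_scale: "\<tau> Z (scV c v) = scV c (\<tau> Z v)"
begin

lemma op_zero [simp]: "\<tau> Z 0 = 0"
  using op_add[of Z 0 0] by simp

lemma op_minus: "\<tau> Z (- v) = - \<tau> Z v"
  by (metis add.right_inverse add_eq_0_iff op_add op_zero)

lemma op_diff: "\<tau> Z (u - v) = \<tau> Z u - \<tau> Z v"
  by (metis diff_conv_add_uminus op_add op_minus)

lemma op_sum: "\<tau> Z (\<Sum>x\<in>A. h x) = (\<Sum>x\<in>A. \<tau> Z (h x))"
  by (induction A rule: infinite_finite_induct) (auto simp: op_add)

lemma word_add: "foldr \<tau> w (u + v) = foldr \<tau> w u + foldr \<tau> w v"
  by (induction w) (auto simp: op_add)

lemma word_scale: "foldr \<tau> w (scV c v) = scV c (foldr \<tau> w v)"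
  by (induction w) (auto simp: op_scale)

lemma word_zero [simp]: "foldr \<tau> w 0 = 0"
  by (induction w) auto

lemma act_superset:
  assumes "finite A" "Poly_Mapping.keys p \<subseteq> A"
  shows "poly_act scV \<tau> p v = (\<Sum>w\<in>A. scV (Poly_Mapping.lookup p w) (foldr \<tau> (letters w) v))"
  unfolding poly_act_def
  by (rule sum.mono_neutral_left) (use assms in \<open>auto simp: in_keys_iff\<close>)

lemma act_add: "poly_act scV \<tau> (p + q) v = poly_act scV \<tau> p v + poly_act scV \<tau> q v"
proof -
  let ?A = "Poly_Mapping.keys p \<union> Poly_Mapping.keys q"
  show ?thesis
    using act_superset[of ?A p v] act_superset[of ?A q v] act_superset[of ?A "p + q" v]
      Poly_Mapping.keys_add[of p q]
    by (simp add: lookup_add scale_left_distrib sum.distrib)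
qed

lemma act_single [simp]:
  "poly_act scV \<tau> (Poly_Mapping.single w c) v = scV c (foldr \<tau> (letters w) v)"
  using act_superset[of "{w}" "Poly_Mapping.single w c" v] by simp

lemma act_zero [simp]: "poly_act scV \<tau> 0 v = 0"
  by (simp add: poly_act_def)

lemma act_uminus: "poly_act scV \<tau> (- p) v = - poly_act scV \<tau> p v"
  by (metis act_add act_zero add.right_inverse add_eq_0_iff)

lemma act_diff: "poly_act scV \<tau> (p - q) v = poly_act scV \<tau> p v - poly_act scV \<tau> q v"
  by (metis act_add act_uminus diff_conv_add_uminus)

lemma act_sum: "poly_act scV \<tau> (\<Sum>x\<in>A. h x) v = (\<Sum>x\<in>A. poly_act scV \<tau> (h x) v)"
  by (induction A rule: infinite_finite_induct) (auto simp: act_add)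

lemma act_mult: "poly_act scV \<tau> (p * q) v = poly_act scV \<tau> p (poly_act scV \<tau> q v)"
proof (induction p rule: poly_mapping_single_induct)
  case (add p p')
  then show ?case by (simp add: distrib_right act_add)
next
  case (single w c)
  show ?case
  proof (induction q rule: poly_mapping_single_induct)
    case (add q q')
    then show ?case by (simp add: distrib_left act_add word_add scale_right_distrib)
  qed (simp add: mult_single plus_fword_def word_scale)
qed

lemma act_subspace:
  assumes K: "subspace K" and stable: "\<And>Z v. Z \<in> g \<Longrightarrow> v \<in> K \<Longrightarrow> \<tau> Z v \<in> K"
    and p: "p \<in> carrier (free_ring g)" and v: "v \<in> K"
  shows "poly_act scV \<tau> p v \<in> K"
proof -
  have "foldr \<tau> w v \<in> K" if "set w \<subseteq> g" for w
    using that by (induction w) (use stable v in auto)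
  then show ?thesis
    unfolding poly_act_def
    by (intro subspace_sum[OF K] subspace_scale[OF K]) (use p in \<open>auto simp: free_ring_def\<close>)
qed

text \<open>The elements of the free algebra that carry \<open>D\<close> into \<open>K\<close> form a two-sided ideal as soon as both
  subspaces are stable, so that relations need only be checked on generators. This one observation
  makes an action of the free algebra descend to an enveloping or a symmetric algebra.\<close>

lemma act_ideal:
  assumes D: "subspace D" "\<And>Z v. Z \<in> g \<Longrightarrow> v \<in> D \<Longrightarrow> \<tau> Z v \<in> D"
    and K: "subspace K" "\<And>Z v. Z \<in> g \<Longrightarrow> v \<in> K \<Longrightarrow> \<tau> Z v \<in> K"
    and S: "S \<subseteq> carrier (free_ring g)" "\<And>p v. p \<in> S \<Longrightarrow> v \<in> D \<Longrightarrow> poly_act scV \<tau> p v \<in> K"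
    and p: "p \<in> Idl\<^bsub>free_ring g\<^esub> S" and v: "v \<in> D"
  shows "poly_act scV \<tau> p v \<in> K"
proof -
  interpret R: ring "free_ring g" by (rule free_ring_is_ring)
  let ?I = "{p \<in> carrier (free_ring g). \<forall>v\<in>D. poly_act scV \<tau> p v \<in> K}"
  have [simp]: "add (free_ring g) = (+)" "zero (free_ring g) = 0" "mult (free_ring g) = (*)"
    by (simp_all add: free_ring_def)
  have neg: "- p \<in> carrier (free_ring g)" if "p \<in> carrier (free_ring g)" for p
    using that by (simp add: free_ring_def)
  have ainv: "\<ominus>\<^bsub>free_ring g\<^esub> p = - p" if "p \<in> carrier (free_ring g)" for p
    using R.minus_equality[of "- p" p] neg that by simp
  have "ideal ?I (free_ring g)"
  proof (rule idealI)
    show "subgroup ?I (add_monoid (free_ring g))"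
    proof (rule R.add.subgroupI)
      show "?I \<noteq> {}" using R.zero_closed subspace_0[OF K(1)] by auto
      fix p q assume "p \<in> ?I" "q \<in> ?I"
      then show "\<ominus>\<^bsub>free_ring g\<^esub> p \<in> ?I" "p \<oplus>\<^bsub>free_ring g\<^esub> q \<in> ?I"
        using R.add.m_closed[of p q] neg ainv
        by (auto simp: act_add act_uminus subspace_add[OF K(1)] subspace_neg[OF K(1)])
    qed auto
  next
    \<comment> \<open>A product with a factor that carries \<open>D\<close> to \<open>K\<close> does so too, since the other factor preserves \<open>D\<close>
      (acting first) or \<open>K\<close> (acting last).\<close>
    fix p q assume "p \<in> ?I" "q \<in> carrier (free_ring g)"
    then show "q \<otimes>\<^bsub>free_ring g\<^esub> p \<in> ?I" "p \<otimes>\<^bsub>free_ring g\<^esub> q \<in> ?I"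
      using R.m_closed[of p q] R.m_closed[of q p] act_subspace[OF D, where p = q]
        act_subspace[OF K, where p = q]
      by (auto simp: act_mult)
  qed (rule R.ring_axioms)
  moreover have "S \<subseteq> ?I" using S by auto
  ultimately show ?thesis using p v R.genideal_minimal by blast
qed

end

text \<open>The value on a coset, as it is used in all quotient constructions below.\<close>

lemma the_elem_constant_image:
  assumes "A \<noteq> {}" "\<And>a. a \<in> A \<Longrightarrow> h a = c"
  shows "the_elem (h ` A) = c"
proof -
  have "h ` A = {c}" using assms by auto
  then show ?thesis by simp
qed

lemma gen_mult: "gen x * gen y = (Poly_Mapping.single (Word [x, y]) 1 :: 'a free_algebra)"
  by (simp add: mult_single plus_fword_def)

section \<open>Enveloping and symmetric algebras as quotients of free algebras\<close>

lemma dual_space_linear: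
  assumes "f \<in> dual_space sc S" "x \<in> S"
  shows "y \<in> S \<Longrightarrow> f (x + y) = f x + f y" "f (sc c x) = c * f x"
  using assms by (auto simp: dual_space_def)

lemma carrier_free_ring_simps [simp]:
  "add (free_ring g) = (+)" "zero (free_ring g) = 0" "mult (free_ring g) = (*)"
  by (simp_all add: free_ring_def)

lemma in_carrier_free_ring:
  "p \<in> carrier (free_ring g) \<longleftrightarrow> (\<forall>w\<in>Poly_Mapping.keys p. set (letters w) \<subseteq> g)"
  by (simp add: free_ring_def)

lemma single_in_free_ring: "set w \<subseteq> g \<Longrightarrow> Poly_Mapping.single (Word w) c \<in> carrier (free_ring g)"
  by (auto simp: in_carrier_free_ring)

lemma add_in_free_ring:
  "p \<in> carrier (free_ring g) \<Longrightarrow> q \<in> carrier (free_ring g) \<Longrightarrow> p + q \<in> carrier (free_ring g)"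
  using ring.ring_simprules(1)[OF free_ring_is_ring] by fastforce

lemma diff_in_free_ring:
  "p \<in> carrier (free_ring g) \<Longrightarrow> q \<in> carrier (free_ring g) \<Longrightarrow> p - q \<in> carrier (free_ring g)"
  using Poly_Mapping.keys_diff[of p q] by (fastforce simp: in_carrier_free_ring)

lemma sum_in_free_ring:
  "(\<And>x. x \<in> A \<Longrightarrow> h x \<in> carrier (free_ring g)) \<Longrightarrow> (\<Sum>x\<in>A. h x) \<in> carrier (free_ring g)"
proof (induction A rule: infinite_finite_induct)
  case (insert x A)
  then show ?case using add_in_free_ring by (metis insert_iff sum.insert)
qed (auto simp: in_carrier_free_ring)

lemma free_coset: "I +>\<^bsub>free_ring g\<^esub> p = {h + p | h. h \<in> I}"
  by (auto simp: a_r_coset_def')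

locale subspace_of = vector_space sc
  for sc :: "complex \<Rightarrow> 'a::ab_group_add \<Rightarrow> 'a" +
  fixes g :: "'a set"
  assumes subspace_g: "subspace g"
begin

lemma linear_rels_carrier: "linear_rels sc g \<subseteq> carrier (free_ring g)"
  unfolding linear_rels_def using subspace_add[OF subspace_g] subspace_scale[OF subspace_g]
  by (auto intro!: diff_in_free_ring single_in_free_ring)

lemma commutators_carrier:
  "{gen x * gen y - gen y * gen x | x y. x \<in> g \<and> y \<in> g} \<subseteq> carrier (free_ring g)"
  unfolding gen_mult by (auto intro!: diff_in_free_ring single_in_free_ring)

lemma ideal_sym_ideal: "ideal (sym_ideal sc g) (free_ring g)"
  unfolding sym_ideal_def
  using linear_rels_carrier commutators_carrier
  by (intro ring.genideal_ideal[OF free_ring_is_ring]) auto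

end

lemma ideal_env_ideal: "ideal (env_ideal sc br) (free_ring UNIV)"
  unfolding env_ideal_def
  by (rule ring.genideal_ideal[OF free_ring_is_ring]) (auto simp: in_carrier_free_ring)

lemma zero_in_ideal: "ideal I (free_ring g) \<Longrightarrow> 0 \<in> I"
  using additive_subgroup.zero_closed ideal.axioms(1) by fastforce

lemma finsum_space_of: "finsum (space_of scV) h A = (\<Sum>x\<in>A. h x)"
proof -
  have simps: "add (space_of scV) = (+)" "zero (space_of scV) = 0" "carrier (space_of scV) = UNIV"
    by (simp_all add: space_of_def)
  interpret V: abelian_monoid "space_of scV"
    by (rule abelian_monoidI) (auto simp: simps algebra_simps)
  show ?thesis
    by (induction A rule: infinite_finite_induct)
      (auto simp: V.finsum_insert V.finsum_infinite simps)
qed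

lemma free_act_space_of: "free_act (space_of scV) \<tau> p v = poly_act scV \<tau> p v"
  by (simp add: free_act_def finsum_space_of poly_act_def) (simp add: space_of_def)

lemma free_eval_poly_act: "free_eval f p = poly_act (*) (\<lambda>x c. f x * c) p 1"
proof -
  have "foldr (\<lambda>x. (*) (f x)) w 1 = prod_list (map f w)" for w
    by (induction w) auto
  then show ?thesis by (simp add: free_eval_def poly_act_def)
qed

lemma operator_family_mult: "operator_family (*) (\<lambda>x c. f x * c :: complex)"
  by unfold_locales (auto simp: algebra_simps)

lemma (in subspace_of) free_eval_sym_ideal:
  assumes f: "f \<in> dual_space sc g" and h: "h \<in> sym_ideal sc g"
  shows "free_eval f h = 0"
proof -
  interpret E: operator_family "(*)" "\<lambda>x c. f x * c :: complex" by (rule operator_family_mult)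
  have "poly_act (*) (\<lambda>x c. f x * c) h 1 \<in> {0}"
  proof (rule E.act_ideal[where D = UNIV and g = g])
    fix p :: "'a free_algebra" and v :: complex
    assume "p \<in> linear_rels sc g \<union> {gen x * gen y - gen y * gen x |x y. x \<in> g \<and> y \<in> g}"
    then show "poly_act (*) (\<lambda>x c. f x * c) p v \<in> {0}"
      by (auto simp: linear_rels_def gen_mult E.act_diff dual_space_linear[OF f] distrib_right)
  next
    show "E.subspace UNIV" "E.subspace {0}" by (auto simp: E.subspace_def)
  qed (use h linear_rels_carrier commutators_carrier in \<open>auto simp: sym_ideal_def\<close>)
  then show ?thesis by (simp add: free_eval_poly_act)
qed

lemma free_eval_add: "free_eval f (p + q) = free_eval f p + free_eval f q"
  using operator_family.act_add[OF operator_family_mult] by (simp add: free_eval_poly_act)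

lemma free_eval_sum: "free_eval f (\<Sum>x\<in>A. h x) = (\<Sum>x\<in>A. free_eval f (h x))"
  using operator_family.act_sum[OF operator_family_mult] by (simp add: free_eval_poly_act)

lemma free_eval_single:
  "free_eval f (Poly_Mapping.single (Word w) c) = c * (\<Prod>x\<leftarrow>w. f x)"
  by (simp add: free_eval_def)

lemma free_eval_mult: "free_eval f (p * q) = free_eval f p * free_eval f q"
proof -
  interpret E: operator_family "(*)" "\<lambda>x c. f x * c :: complex" by (rule operator_family_mult)
  have "poly_act (*) (\<lambda>x c. f x * c) p v = poly_act (*) (\<lambda>x c. f x * c) p 1 * v" for p v
  proof -
    have "foldr (\<lambda>x. (*) (f x)) w v = foldr (\<lambda>x. (*) (f x)) w 1 * v" for w
      by (induction w) auto
    then show ?thesis 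
      unfolding poly_act_def sum_distrib_right
      by (intro sum.cong refl) (metis mult.assoc)
  qed
  then show ?thesis unfolding free_eval_poly_act E.act_mult .
qed

lemma (in subspace_of) sym_eval_class:
  assumes f: "f \<in> dual_space sc g"
  shows "sym_eval f (sym_class sc g p) = free_eval f p"
  unfolding sym_eval_def sym_class_def free_coset
  using zero_in_ideal[OF ideal_sym_ideal]
  by (intro the_elem_constant_image) (auto simp: free_eval_add free_eval_sym_ideal[OF f])

context lie_module
begin

lemma action_add_left: "\<rho> (Z + W) v = \<rho> Z v + \<rho> W v"
  and action_scale_left: "\<rho> (sc c Z) v = scM c (\<rho> Z v)"
  using action_linear_left[of v] by (auto simp: Vector_Spaces.linear_iff)

lemma operator_family_action: "operator_family scM \<rho>"
  using action_linear_right M.vector_space_axioms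
  by (auto simp: operator_family_def operator_family_axioms_def Vector_Spaces.linear_iff)

sublocale Act: operator_family scM \<rho>
  by (rule operator_family_action)

lemma env_ideal_acts_trivially:
  assumes h: "h \<in> env_ideal sc br"
  shows "poly_act scM \<rho> h v = 0"
proof -
  have "poly_act scM \<rho> h v \<in> {0}"
  proof (rule Act.act_ideal[where D = UNIV and g = UNIV])
    fix p :: "'a free_algebra" and v
    assume "p \<in> linear_rels sc UNIV \<union> {gen x * gen y - gen y * gen x - gen (br x y) | x y. True}"
    then show "poly_act scM \<rho> p v \<in> {0}"
      by (auto simp: linear_rels_def gen_mult Act.act_diff action_add_left action_scale_left
          action_bracket)
  next
    show "M.subspace UNIV" "M.subspace {0}" by (auto simp: M.subspace_def)
  qed (use h in \<open>auto simp: env_ideal_def in_carrier_free_ring\<close>)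
  then show ?thesis by simp
qed

lemma env_act_class: "env_act scM \<rho> (env_class sc br p) v = poly_act scM \<rho> p v"
  unfolding env_act_def env_class_def free_coset free_act_space_of
  using zero_in_ideal[OF ideal_env_ideal[of sc br]]
  by (intro the_elem_constant_image) (auto simp: Act.act_add env_ideal_acts_trivially)

end

lemma env_class_add:
  "env_class sc br p \<oplus>\<^bsub>Env sc br\<^esub> env_class sc br q = env_class sc br (p + q)"
  using ring_hom_add[OF ideal.rcos_ring_hom[OF ideal_env_ideal[of sc br]], of p q]
  by (simp add: Env_def env_class_def in_carrier_free_ring)

text \<open>Orders and symbols are only visible on representatives. The remainder \<open>r\<close> is zero for \<open>k = 0\<close>, where the
  preceding step of the filtration is zero by convention.\<close>

lemma symbol_representative:
  assumes "is_symbol sc br u s" "u \<in> carrier (Env sc br)"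
  obtains k t r where
    "\<forall>w\<in>Poly_Mapping.keys t. length (letters w) = k"
    "\<forall>w\<in>Poly_Mapping.keys r. length (letters w) < k"
    "u = env_class sc br (t + r)" "s = sym_class sc UNIV t"
proof -
  interpret E: ring "Env sc br"
    unfolding Env_def by (rule ideal.quotient_is_ring[OF ideal_env_ideal])
  obtain k t where t: "\<forall>w\<in>Poly_Mapping.keys t. length (letters w) = k"
    and d: "u \<ominus>\<^bsub>Env sc br\<^esub> env_class sc br t
      \<in> prev_step \<zero>\<^bsub>Env sc br\<^esub> (env_filtration sc br) k"
    and s: "s = sym_class sc UNIV t"
    using assms(1) unfolding is_symbol_def by auto
  have zero: "\<zero>\<^bsub>Env sc br\<^esub> = env_class sc br 0"
    by (auto simp: Env_def env_class_def free_coset FactRing_def)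
  have "\<exists>r. (\<forall>w\<in>Poly_Mapping.keys r. length (letters w) < k) \<and>
      u \<ominus>\<^bsub>Env sc br\<^esub> env_class sc br t = env_class sc br r"
  proof (cases k)
    case 0
    then show ?thesis using d zero by (auto simp: prev_step_def intro!: exI[of _ 0])
  next
    case (Suc l)
    then show ?thesis using d by (auto simp: prev_step_def env_filtration_def less_Suc_eq_le)
  qed
  then obtain r where r: "\<forall>w\<in>Poly_Mapping.keys r. length (letters w) < k"
    and ur: "u \<ominus>\<^bsub>Env sc br\<^esub> env_class sc br t = env_class sc br r"
    by blast
  have tc: "env_class sc br t \<in> carrier (Env sc br)"
    using ring_hom_closed[OF ideal.rcos_ring_hom[OF ideal_env_ideal[of sc br]], of t]
    by (simp add: Env_def env_class_def in_carrier_free_ring)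
  have "u = env_class sc br t \<oplus>\<^bsub>Env sc br\<^esub> (u \<ominus>\<^bsub>Env sc br\<^esub> env_class sc br t)"
    using assms(2) tc by (simp add: a_minus_def E.r_neg E.r_neg2 E.r_neg1 E.a_ac)
  then have "u = env_class sc br (t + r)" by (simp add: ur env_class_add)
  then show ?thesis using that t r s by blast
qed

text \<open>The elements of the symmetric algebra that vanish at \<open>f\<close> form an ideal, so membership in the
  annihilator variety only has to be tested on symbols. Each symbol is represented by the leading
  part \<open>t\<close> of some free polynomial \<open>t + r\<close> that kills the module.\<close>

lemma (in lie_module) in_annihilator_varietyI:
  assumes f: "f \<in> dual_space sc UNIV"
    and vanish: "\<And>k t r. \<forall>w\<in>Poly_Mapping.keys t. length (letters w) = k \<Longrightarrow>
      \<forall>w\<in>Poly_Mapping.keys r. length (letters w) < k \<Longrightarrow>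
      (\<And>v. poly_act scM \<rho> (t + r) v = 0) \<Longrightarrow> free_eval f t = 0"
  shows "f \<in> annihilator_variety sc br scM \<rho>"
proof -
  interpret S: subspace_of sc UNIV by unfold_locales (rule subspace_UNIV)
  let ?R = "free_ring UNIV" and ?I = "sym_ideal sc UNIV"
  interpret I: ideal ?I ?R by (rule S.ideal_sym_ideal)
  interpret Sym: ring "Sym sc UNIV" unfolding Sym_def by (rule I.quotient_is_ring)
  have hom: "sym_class sc UNIV \<in> ring_hom ?R (Sym sc UNIV)"
    using I.rcos_ring_hom by (simp add: Sym_def sym_class_def[abs_def])
  have carrier: "p \<in> carrier ?R" for p by (simp add: in_carrier_free_ring)
  have surj: "\<exists>p. s = sym_class sc UNIV p" if "s \<in> carrier (Sym sc UNIV)" for s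
    using that by (auto simp: Sym_def FactRing_def A_RCOSETS_def' sym_class_def a_r_coset_def')
  let ?J = "{s \<in> carrier (Sym sc UNIV). sym_eval f s = 0}"
  have mem: "sym_class sc UNIV p \<in> ?J \<longleftrightarrow> free_eval f p = 0" for p
    using ring_hom_closed[OF hom carrier] by (simp add: S.sym_eval_class[OF f])
  have add: "sym_class sc UNIV p \<oplus>\<^bsub>Sym sc UNIV\<^esub> sym_class sc UNIV q = sym_class sc UNIV (p + q)"
    and mult: "sym_class sc UNIV p \<otimes>\<^bsub>Sym sc UNIV\<^esub> sym_class sc UNIV q = sym_class sc UNIV (p * q)"
    for p q
    using ring_hom_add[OF hom carrier carrier, of p q] ring_hom_mult[OF hom carrier carrier, of p q]
    by simp_all
  have zero: "\<zero>\<^bsub>Sym sc UNIV\<^esub> = sym_class sc UNIV 0"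
    using ring_hom_zero[OF hom I.ring_axioms Sym.ring_axioms] by simp
  have uminus: "\<ominus>\<^bsub>Sym sc UNIV\<^esub> sym_class sc UNIV p = sym_class sc UNIV (- p)" for p
    using ring_hom_closed[OF hom carrier]
    by (intro Sym.minus_equality) (simp_all add: add zero)
  have neg: "free_eval f (- p) = - free_eval f p" for p
    using free_eval_add[of f p "- p"] by (simp add: free_eval_def eq_neg_iff_add_eq_0 add.commute)
  have "ideal ?J (Sym sc UNIV)"
  proof (rule idealI)
    show "subgroup ?J (add_monoid (Sym sc UNIV))"
    proof (rule Sym.add.subgroupI)
      show "?J \<noteq> {}" using mem[of 0] by (auto simp: free_eval_def)
    next
      fix a assume "a \<in> ?J"
      moreover from this obtain p where "a = sym_class sc UNIV p" using surj by auto
      ultimately show "\<ominus>\<^bsub>Sym sc UNIV\<^esub> a \<in> ?J" using mem uminus neg by simp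
    next
      fix a b assume "a \<in> ?J" "b \<in> ?J"
      moreover from this obtain p q where "a = sym_class sc UNIV p" "b = sym_class sc UNIV q"
        using surj by blast
      ultimately show "a \<oplus>\<^bsub>Sym sc UNIV\<^esub> b \<in> ?J" using mem add by (simp add: free_eval_add)
    qed auto
  next
    fix a b assume ab: "a \<in> ?J" "b \<in> carrier (Sym sc UNIV)"
    then obtain p q where "a = sym_class sc UNIV p" "b = sym_class sc UNIV q"
      using surj by blast
    then show "b \<otimes>\<^bsub>Sym sc UNIV\<^esub> a \<in> ?J" "a \<otimes>\<^bsub>Sym sc UNIV\<^esub> b \<in> ?J"
      using ab(1) mem mult by (simp_all add: free_eval_mult)
  qed (rule Sym.ring_axioms)
  moreover have "{s. \<exists>u\<in>carrier (Env sc br). (\<forall>v. env_act scM \<rho> u v = 0) \<and> is_symbol sc br u s} \<subseteq> ?J"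
  proof safe
    fix s u
    assume u: "u \<in> carrier (Env sc br)" "\<forall>v. env_act scM \<rho> u v = 0" and s: "is_symbol sc br u s"
    obtain k t r where "\<forall>w\<in>Poly_Mapping.keys t. length (letters w) = k"
      "\<forall>w\<in>Poly_Mapping.keys r. length (letters w) < k"
      and rep: "u = env_class sc br (t + r)" "s = sym_class sc UNIV t"
      using symbol_representative[OF s u(1)] .
    moreover from u(2) rep have "poly_act scM \<rho> (t + r) v = 0" for v
      by (simp add: env_act_class)
    ultimately have "free_eval f t = 0" using vanish by blast
    then show "s \<in> carrier (Sym sc UNIV)" "sym_eval f s = 0" using mem rep(2) by auto
  qed
  ultimately show ?thesis
    unfolding annihilator_variety_def zero_set_def using f Sym.genideal_minimal by blast
qed

section \<open>Eigencomponents and weight bases\<close>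

context vector_space
begin

text \<open>Eigenvectors for distinct eigenvalues are independent. The operator \<open>T\<close> is later taken to be
  \<open>ad Y\<close> on the Lie algebra and also the commutator with an action operator on the space of all maps
  of the module to itself.\<close>

lemma eigencomponents_zero:
  assumes T: "\<And>u v. T (u + v) = T u + T v" "\<And>c v. T (scale c v) = scale c (T v)"
    and fin: "finite S"
    and eig: "\<And>l. l \<in> S \<Longrightarrow> T (z l) = scale l (z l)" and zero: "(\<Sum>l\<in>S. z l) = 0"
    and l: "l \<in> S"
  shows "z l = 0"
  using fin eig zero l
proof (induction S arbitrary: z l)
  case (insert m S)
  have T0: "T 0 = 0" using T(1)[of 0 0] by simp
  have Tsum: "T (\<Sum>l\<in>A. h l) = (\<Sum>l\<in>A. T (h l))" for h and A :: "'a set"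
    by (induction A rule: infinite_finite_induct) (auto simp: T T0)
  \<comment> \<open>Apply \<open>T - m\<close>: it kills the component \<open>z m\<close> and multiplies each other one by a nonzero scalar.\<close>
  have "(\<Sum>l\<in>insert m S. scale l (z l)) = T (\<Sum>l\<in>insert m S. z l)"
    unfolding Tsum by (intro sum.cong refl) (simp add: insert.prems)
  also have "\<dots> = 0" using insert.prems T0 by simp
  finally have "(\<Sum>l\<in>insert m S. scale (l - m) (z l)) = 0"
    using insert.prems(2) by (simp add: scale_left_diff_distrib sum_subtractf flip: scale_sum_right)
  then have "(\<Sum>l\<in>S. scale (l - m) (z l)) = 0" using insert.hyps by simp
  then have *: "scale (l - m) (z l) = 0" if "l \<in> S" for l
    by (rule insert.IH[rotated]) (use insert.prems that in \<open>auto simp: T mult.commute\<close>)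
  have S: "z l = 0" if "l \<in> S" for l using *[OF that] that insert.hyps by auto
  then have "z m = 0" using insert.prems(2) insert.hyps by simp
  with S show ?case using insert.prems(3) by auto
qed simp

lemma span_eigenvectors_decompose:
  assumes T: "\<And>u v. T (u + v) = T u + T v" "\<And>c v. T (scale c v) = scale c (T v)"
    and v: "v \<in> span {v. \<exists>c. T v = scale c v}"
  obtains S z where "finite S" "\<And>l. T (z l) = scale l (z l)" "v = (\<Sum>l\<in>S. z l)"
proof -
  have T0: "T 0 = 0" using T(1)[of 0 0] by simp
  have "\<exists>S z. finite S \<and> (\<forall>l. T (z l) = scale l (z l)) \<and> (\<forall>l. l \<notin> S \<longrightarrow> z l = 0) \<and> v = (\<Sum>l\<in>S. z l)"
    using v
  proof (induction rule: span_induct_alt)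
    case base
    show ?case by (rule exI[of _ "{}"], rule exI[of _ "\<lambda>_. 0"]) (simp add: T0)
  next
    case (step c x y)
    from step(1) obtain m where m: "T x = scale m x" by auto
    from step(2) obtain S z where S: "finite S" "\<forall>l. T (z l) = scale l (z l)"
      "\<forall>l. l \<notin> S \<longrightarrow> z l = 0" "y = (\<Sum>l\<in>S. z l)" by auto
    \<comment> \<open>The family \<open>z\<close> vanishes off \<open>S\<close>, so adding to its value at \<open>m\<close> is right whether or not \<open>m \<in> S\<close>.\<close>
    let ?z = "z(m := scale c x + z m)"
    have "y = (\<Sum>l\<in>insert m S. z l)" using S by (cases "m \<in> S") (auto simp: insert_absorb)
    also have "\<dots> = z m + (\<Sum>l\<in>S - {m}. z l)" using S(1) by (rule sum.insert_remove)
    finally have "scale c x + y = ?z m + (\<Sum>l\<in>S - {m}. ?z l)" by (simp add: add.assoc)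
    also have "\<dots> = (\<Sum>l\<in>insert m S. ?z l)" using S(1) by (simp add: sum.insert_remove)
    finally show ?case
      using S m by (intro exI[of _ "insert m S"] exI[of _ ?z]) (auto simp: T scale_right_distrib mult.commute)
  qed
  then show ?thesis using that by metis
qed

end

lemma dual_space_sum:
  assumes sc: "vector_space sc" and f: "f \<in> dual_space sc S" and S: "module.subspace sc S"
    and A: "\<And>b. b \<in> A \<Longrightarrow> h b \<in> S"
  shows "f (\<Sum>b\<in>A. sc (c b) (h b)) = (\<Sum>b\<in>A. c b * f (h b))"
proof -
  interpret vector_space sc by fact
  have f0: "f 0 = 0"
    using dual_space_linear(2)[OF f subspace_0[OF S], of 0] by simp
  have "(\<Sum>b\<in>A. sc (c b) (h b)) \<in> S \<and> f (\<Sum>b\<in>A. sc (c b) (h b)) = (\<Sum>b\<in>A. c b * f (h b))"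
    using A
    by (induction A rule: infinite_finite_induct)
      (auto simp: f0 subspace_0[OF S] subspace_add[OF S] subspace_scale[OF S]
        dual_space_linear[OF f])
  then show ?thesis by blast
qed

locale bigraded_lie_algebra = complex_lie_algebra sc br
  for sc :: "complex \<Rightarrow> 'a::ab_group_add \<Rightarrow> 'a" and br +
  fixes X Y :: 'a
  assumes commute: "br X Y = 0"
    and ssX: "ad_semisimple sc br X" and intX: "integer_ad_eigenvalues sc br X"
    and ssY: "ad_semisimple sc br Y" and intY: "integer_ad_eigenvalues sc br Y"
begin

abbreviation wt :: "int \<Rightarrow> int \<Rightarrow> 'a set" where "wt \<equiv> weight_space sc br X Y"

lemma br_add_left: "br (x + y) z = br x z + br y z"
  and br_scale_left: "br (sc c x) z = sc c (br x z)"
  using bracket_linear_left[of z] by (auto simp: Vector_Spaces.linear_iff)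

lemma br_add_right: "br z (x + y) = br z x + br z y"
  and br_scale_right: "br z (sc c x) = sc c (br z x)"
  using bracket_linear_right[of z] by (auto simp: Vector_Spaces.linear_iff)

lemma br_antisym: "br x y = - br y x"
proof -
  have "br x y + br y x = br (x + y) (x + y)"
    unfolding br_add_left br_add_right by (simp add: bracket_self)
  then have "br x y + br y x = 0" by (simp only: bracket_self)
  then show ?thesis by (simp add: eq_neg_iff_add_eq_0)
qed

lemma br_zero_right [simp]: "br z 0 = 0" using br_add_right[of z 0 0] by simp

lemma br_minus_right: "br z (- x) = - br z x"
  by (metis add.right_inverse add_eq_0_iff br_add_right br_zero_right)

lemma br_derivation: "br x (br y z) = br (br x y) z + br y (br x z)"
  using jacobi[of x y z] br_antisym[of z x] br_antisym[of z "br x y"]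
  by (simp add: br_minus_right algebra_simps eq_neg_iff_add_eq_0)

lemma br_sum_right: "br z (\<Sum>a\<in>A. h a) = (\<Sum>a\<in>A. br z (h a))"
  by (induction A rule: infinite_finite_induct) (auto simp: br_add_right)

lemma wt_bracket: "Z \<in> wt i j \<Longrightarrow> W \<in> wt i' j' \<Longrightarrow> br Z W \<in> wt (i + i') (j + j')"
  by (simp add: weight_space_def br_derivation[of _ Z W] br_scale_left br_scale_right
      scale_left_distrib)

lemma subspace_wt: "subspace (wt i j)"
  by (auto simp: subspace_def weight_space_def br_add_right br_scale_right scale_right_distrib
      mult.commute)

text \<open>Commuting diagonalizable operators are simultaneously diagonalizable: the \<open>Y\<close>-eigencomponents of
  an \<open>X\<close>-eigenvector are again \<open>X\<close>-eigenvectors, with the same eigenvalue.\<close>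

lemma span_wt: "span (\<Union>i j. wt i j) = UNIV"
proof -
  have "Z \<in> span (\<Union>i j. wt i j)" if Z: "br X Z = sc c Z" for Z c
  proof -
    have "Z \<in> span {Z. \<exists>c. br Y Z = sc c Z}" using ssY by (simp add: ad_semisimple_def)
    then obtain S z where S: "finite S" "\<And>l. br Y (z l) = sc l (z l)" "Z = (\<Sum>l\<in>S. z l)"
      by (rule span_eigenvectors_decompose[OF br_add_right br_scale_right]) auto
    have XY: "br Y (br X u) = br X (br Y u)" for u
      using br_derivation[of X Y u] commute br_add_left[of 0 0 u] by simp
    \<comment> \<open>The \<open>Y\<close>-eigencomponents of \<open>br X Z - sc c Z = 0\<close>.\<close>
    let ?w = "\<lambda>l. br X (z l) - sc c (z l)"
    have "(\<Sum>l\<in>S. ?w l) = 0"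
      using Z S(3) by (simp add: sum_subtractf br_sum_right scale_sum_right)
    moreover have "br Y (?w l) = sc l (?w l)" for l
      using br_minus_right[of Y] br_add_right[of Y "br X (z l)" "- sc c (z l)"]
      by (simp add: XY S(2) br_scale_right scale_right_diff_distrib mult.commute)
    ultimately have w: "?w l = 0" if "l \<in> S" for l
      using eigencomponents_zero[of "br Y" S ?w, OF br_add_right br_scale_right S(1)] that by blast
    have "z l \<in> span (\<Union>i j. wt i j)" if "l \<in> S" for l
    proof (cases "z l = 0")
      case False
      then have "c \<in> \<int>" "l \<in> \<int>"
        using intX intY w[OF that] S(2) unfolding integer_ad_eigenvalues_def
        by (metis eq_iff_diff_eq_0)+
      then obtain i j where "c = of_int i" "l = of_int j" by (auto elim!: Ints_cases)
      then have "z l \<in> wt i j" using w[OF that] S(2)[of l] by (simp add: weight_space_def)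
      then show ?thesis by (intro span_base) auto
    qed (simp add: span_zero)
    then show ?thesis unfolding S(3) by (rule span_sum)
  qed
  then have "span {Z. \<exists>c. br X Z = sc c Z} \<subseteq> span (\<Union>i j. wt i j)"
    by (intro span_minimal) auto
  then show ?thesis using ssX by (auto simp: ad_semisimple_def)
qed

end

locale weight_basis = bigraded_lie_algebra sc br X Y
  for sc :: "complex \<Rightarrow> 'a::ab_group_add \<Rightarrow> 'a" and br X Y +
  fixes B :: "'a set" and wx wy :: "'a \<Rightarrow> int"
  assumes finite_B: "finite B" and independent_B: "independent B" and span_B: "span B = UNIV"
    and wt_B: "b \<in> B \<Longrightarrow> b \<in> weight_space sc br X Y (wx b) (wy b)"

lemma (in bigraded_lie_algebra) weight_basis_exists:
  obtains B wx wy where "weight_basis sc br X Y B wx wy"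
proof -
  obtain B where B: "B \<subseteq> (\<Union>i j. wt i j)" "independent B" "(\<Union>i j. wt i j) \<subseteq> span B"
    using maximal_independent_subset by blast
  have span: "span B = UNIV"
    using span_minimal[OF B(3) subspace_span] span_wt by auto
  obtain C where C: "finite C" "span C = UNIV" using finite_dim by blast
  have fin: "finite B" using independent_span_bound[OF C(1) B(2)] C(2) by auto
  have "\<forall>b\<in>B. \<exists>ij. b \<in> wt (fst ij) (snd ij)" using B(1) by fastforce
  then obtain w where "\<forall>b\<in>B. b \<in> wt (fst (w b)) (snd (w b))" by metis
  then have "weight_basis sc br X Y B (\<lambda>b. fst (w b)) (\<lambda>b. snd (w b))"
    using B span fin by unfold_locales auto
  then show ?thesis by (rule that)
qed

context weight_basis
begin

abbreviation coord :: "'a \<Rightarrow> 'a \<Rightarrow> complex" where "coord \<equiv> representation B"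

lemma coord_sum: "(\<Sum>b\<in>B. sc (coord Z b) b) = Z"
  by (rule sum_representation_eq) (auto simp: independent_B span_B finite_B)

text \<open>Compare coordinates in \<open>br X Z = sc i Z\<close> and \<open>br Y Z = sc j Z\<close>.\<close>

lemma coord_weight:
  assumes Z: "Z \<in> wt i j" and b: "b \<in> B" "coord Z b \<noteq> 0"
  shows "wx b = i \<and> wy b = j"
proof -
  have *: "c b = l" if T: "\<And>b. b \<in> B \<Longrightarrow> br x b = sc (c b) b" "br x Z = sc l Z"
    for x c l
  proof -
    have "(\<Sum>b\<in>B. sc (coord Z b * c b) b) = br x (\<Sum>b\<in>B. sc (coord Z b) b)"
      unfolding br_sum_right by (intro sum.cong refl) (simp add: br_scale_right T)
    also have "\<dots> = sc l (\<Sum>b\<in>B. sc (coord Z b) b)" unfolding coord_sum by (rule T(2))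
    also have "\<dots> = (\<Sum>b\<in>B. sc (coord Z b * l) b)" by (simp add: scale_sum_right mult.commute)
    finally have "(\<Sum>b\<in>B. sc (coord Z b * (c b - l)) b) = 0"
      by (simp add: right_diff_distrib scale_left_diff_distrib sum_subtractf)
    then have "coord Z b * (c b - l) = 0"
      using independentD[OF independent_B finite_B subset_refl _ b(1),
          where u = "\<lambda>b. coord Z b * (c b - l)"] by simp
    then show ?thesis using b(2) by simp
  qed
  have "of_int (wx b) = (of_int i :: complex)"
    by (rule *[of X]) (use Z wt_B in \<open>auto simp: weight_space_def\<close>)
  moreover have "of_int (wy b) = (of_int j :: complex)"
    by (rule *[of Y]) (use Z wt_B in \<open>auto simp: weight_space_def\<close>)
  ultimately show ?thesis by simp
qed

text \<open>Existence: prescribe the values on the weight basis; by \<open>coord_weight\<close> a vector of weight \<open>(i,j)\<close> only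
  involves basis vectors of that weight. Uniqueness: the weight spaces span. Hence the description
  that defines the glued functional denotes it.\<close>

lemma glued_functional_correct:
  assumes \<phi>: "\<phi> \<in> dual_space sc (wt 0 1)"
    and \<xi>: "\<xi> \<in> dual_space sc S" and S: "subspace S" "wt 1 0 \<subseteq> S"
  defines "f \<equiv> glued_functional sc br X Y \<phi> \<xi>"
  shows "f \<in> dual_space sc UNIV"
    and "Z \<in> wt 0 1 \<Longrightarrow> f Z = \<phi> Z" and "Z \<in> wt 1 0 \<Longrightarrow> f Z = \<xi> Z"
    and "(i, j) \<notin> {(0, 1), (1, 0)} \<Longrightarrow> Z \<in> wt i j \<Longrightarrow> f Z = 0"
proof -
  let ?P = "\<lambda>f. f \<in> dual_space sc UNIV \<and> (\<forall>Z\<in>wt 0 1. f Z = \<phi> Z) \<and> (\<forall>Z\<in>wt 1 0. f Z = \<xi> Z) \<and>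
    (\<forall>i j. (i, j) \<notin> {(0, 1), (1, 0)} \<longrightarrow> (\<forall>Z\<in>wt i j. f Z = 0))"
  define v where "v b = (if wx b = 0 \<and> wy b = 1 then \<phi> b
    else if wx b = 1 \<and> wy b = 0 then \<xi> b else 0)" for b
  define h where "h Z = (\<Sum>b\<in>B. coord Z b * v b)" for Z
  have "h \<in> dual_space sc UNIV"
    by (auto simp: dual_space_def h_def representation_add representation_scale independent_B span_B
        distrib_right sum.distrib sum_distrib_left mult.assoc)
  moreover have h: "h Z = (\<Sum>b | b \<in> B \<and> wx b = i \<and> wy b = j. coord Z b * v b)"
      "Z = (\<Sum>b | b \<in> B \<and> wx b = i \<and> wy b = j. sc (coord Z b) b)" if "Z \<in> wt i j" for Z i j
  proof -
    show "h Z = (\<Sum>b | b \<in> B \<and> wx b = i \<and> wy b = j. coord Z b * v b)"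
      unfolding h_def using finite_B coord_weight[OF that]
      by (intro sum.mono_neutral_right) auto
    have "Z = (\<Sum>b\<in>B. sc (coord Z b) b)" by (simp add: coord_sum)
    also have "\<dots> = (\<Sum>b | b \<in> B \<and> wx b = i \<and> wy b = j. sc (coord Z b) b)"
      using finite_B coord_weight[OF that] by (intro sum.mono_neutral_right) auto
    finally show "Z = \<dots>" .
  qed
  moreover have "h Z = \<phi> Z" if "Z \<in> wt 0 1" for Z
  proof -
    have "\<phi> Z = (\<Sum>b | b \<in> B \<and> wx b = 0 \<and> wy b = 1. coord Z b * \<phi> b)"
      by (subst h(2)[OF that], rule dual_space_sum[OF vector_space_axioms \<phi> subspace_wt])
        (use wt_B in force)
    then show ?thesis by (simp add: h(1)[OF that] v_def)
  qed
  moreover have "h Z = \<xi> Z" if "Z \<in> wt 1 0" for Z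
  proof -
    have "\<xi> Z = (\<Sum>b | b \<in> B \<and> wx b = 1 \<and> wy b = 0. coord Z b * \<xi> b)"
      by (subst h(2)[OF that], rule dual_space_sum[OF vector_space_axioms \<xi> S(1)])
        (use wt_B S(2) in force)
    then show ?thesis by (simp add: h(1)[OF that] v_def)
  qed
  moreover have "h Z = 0" if "(i, j) \<notin> {(0, 1), (1, 0)}" "Z \<in> wt i j" for i j Z
    unfolding h(1)[OF that(2)] using that(1) by (intro sum.neutral) (auto simp: v_def)
  ultimately have "?P h" by blast
  moreover have "f' = h" if "?P f'" for f'
  proof
    fix Z
    let ?E = "{Z. f' Z = h Z}"
    have f': "f' \<in> dual_space sc UNIV" and h: "h \<in> dual_space sc UNIV"
      using that \<open>?P h\<close> by blast+
    have "f' 0 = h 0"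
      using dual_space_linear(2)[OF f', of 0 0] dual_space_linear(2)[OF h, of 0 0] by simp
    then have "subspace ?E"
      by (simp add: subspace_def dual_space_linear[OF f'] dual_space_linear[OF h])
    moreover have "Z \<in> ?E" if Z: "Z \<in> wt i j" for Z i j
    proof (cases "(i, j) \<in> {(0, 1), (1, 0)}")
      case True
      then consider "Z \<in> wt 0 1" | "Z \<in> wt 1 0" using Z by auto
      then show ?thesis
      proof cases
        case 1
        then have "f' Z = \<phi> Z" "h Z = \<phi> Z" using \<open>?P f'\<close> \<open>?P h\<close> by blast+
        then show ?thesis by simp
      next
        case 2
        then have "f' Z = \<xi> Z" "h Z = \<xi> Z" using \<open>?P f'\<close> \<open>?P h\<close> by blast+
        then show ?thesis by simp
      qed
    next
      case False
      then have "f' Z = 0" "h Z = 0" using \<open>?P f'\<close> \<open>?P h\<close> Z by blast+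
      then show ?thesis by simp
    qed
    ultimately have "span (\<Union>i j. wt i j) \<subseteq> ?E" by (intro span_minimal) auto
    then show "f' Z = h Z" using span_wt by auto
  qed
  ultimately have "?P f"
    unfolding f_def glued_functional_def by (rule theI[where P = ?P])
  then show "f \<in> dual_space sc UNIV"
    and "Z \<in> wt 0 1 \<Longrightarrow> f Z = \<phi> Z" and "Z \<in> wt 1 0 \<Longrightarrow> f Z = \<xi> Z"
    and "(i, j) \<notin> {(0, 1), (1, 0)} \<Longrightarrow> Z \<in> wt i j \<Longrightarrow> f Z = 0"
    by blast+
qed

definition basis_words :: "nat \<Rightarrow> 'a list set"
  where "basis_words n = {bs. set bs \<subseteq> B \<and> length bs = n}"

definition word_coord :: "'a list \<Rightarrow> 'a list \<Rightarrow> complex"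
  where "word_coord w bs = prod_list (map2 coord w bs)"

text \<open>The coordinate of a free polynomial at a basis word, after each of its letters has been expanded in
  the weight basis. Expansion preserves the length of words, so only words of equal length
  contribute.\<close>

definition poly_coord :: "'a free_algebra \<Rightarrow> 'a list \<Rightarrow> complex"
  where "poly_coord p bs =
    (\<Sum>w | w \<in> Poly_Mapping.keys p \<and> length (letters w) = length bs.
      Poly_Mapping.lookup p w * word_coord (letters w) bs)"

lemma finite_basis_words [simp]: "finite (basis_words n)"
  unfolding basis_words_def using finite_lists_length_eq[OF finite_B] .

lemma word_expansion:
  assumes \<tau>: "operator_family scV \<tau>"
    and left: "\<And>Z v. \<tau> Z v = (\<Sum>b\<in>B. scV (coord Z b) (\<tau> b v))"
  shows "foldr \<tau> w v =
    (\<Sum>bs\<in>basis_words (length w). scV (word_coord w bs) (foldr \<tau> bs v))"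
proof (induction w)
  case Nil
  interpret V: operator_family scV \<tau> by fact
  have "basis_words 0 = {[]}" by (auto simp: basis_words_def)
  then show ?case by (simp add: word_coord_def)
next
  case (Cons z w)
  interpret V: operator_family scV \<tau> by fact
  have words: "basis_words (Suc n) = (\<lambda>(b, bs). b # bs) ` (B \<times> basis_words n)" for n
    by (auto simp: basis_words_def length_Suc_conv image_iff)
  have inj: "inj_on (\<lambda>(b, bs). b # bs) (B \<times> basis_words n)" for n
    by (auto simp: inj_on_def)
  have "foldr \<tau> (z # w) v =
      (\<Sum>b\<in>B. \<Sum>bs\<in>basis_words (length w). scV (coord z b * word_coord w bs) (\<tau> b (foldr \<tau> bs v)))"
    by (simp add: left[of z] Cons.IH V.op_sum V.op_scale V.scale_sum_right)
        (subst sum.swap, simp add: mult.commute)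
  also have "\<dots> = (\<Sum>bs\<in>basis_words (length (z # w)). scV (word_coord (z # w) bs) (foldr \<tau> bs v))"
    unfolding length_Cons words sum.reindex[OF inj] sum.cartesian_product
    by (simp add: word_coord_def split_def)
  finally show ?case .
qed

lemma poly_expansion:
  assumes \<tau>: "operator_family scV \<tau>"
    and left: "\<And>Z v. \<tau> Z v = (\<Sum>b\<in>B. scV (coord Z b) (\<tau> b v))"
    and deg: "\<And>w. w \<in> Poly_Mapping.keys p \<Longrightarrow> length (letters w) \<le> k"
  shows "poly_act scV \<tau> p v =
    (\<Sum>bs\<in>(\<Union>n\<le>k. basis_words n). scV (poly_coord p bs) (foldr \<tau> bs v))"
proof -
  interpret V: operator_family scV \<tau> by fact
  let ?W = "\<Union>n\<le>k. basis_words n"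
  have words: "basis_words n = {bs \<in> ?W. length bs = n}" if "n \<le> k" for n
    using that by (auto simp: basis_words_def)
  have fin: "finite ?W" by simp
  let ?t = "\<lambda>w bs. if length (letters w) = length bs
    then scV (Poly_Mapping.lookup p w * word_coord (letters w) bs) (foldr \<tau> bs v) else 0"
  have "poly_act scV \<tau> p v = (\<Sum>w\<in>Poly_Mapping.keys p. \<Sum>bs\<in>?W. ?t w bs)"
    unfolding poly_act_def
  proof (intro sum.cong refl)
    fix w assume "w \<in> Poly_Mapping.keys p"
    then have "basis_words (length (letters w)) = {bs \<in> ?W. length bs = length (letters w)}"
      by (intro words deg)
    then have "foldr \<tau> (letters w) v = (\<Sum>bs | bs \<in> ?W \<and> length bs = length (letters w).
        scV (word_coord (letters w) bs) (foldr \<tau> bs v))"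
      using word_expansion[OF \<tau> left, of "letters w" v] by simp
    then show "scV (Poly_Mapping.lookup p w) (foldr \<tau> (letters w) v) = (\<Sum>bs\<in>?W. ?t w bs)"
      using sum.inter_filter[OF fin, of _ "\<lambda>bs. length bs = length (letters w)"]
      by (simp add: V.scale_sum_right eq_commute cong: if_cong)
  qed
  also have "\<dots> = (\<Sum>bs\<in>?W. \<Sum>w\<in>Poly_Mapping.keys p. ?t w bs)" by (rule sum.swap)
  also have "\<dots> = (\<Sum>bs\<in>?W. scV (poly_coord p bs) (foldr \<tau> bs v))"
    unfolding poly_coord_def V.scale_sum_left
    by (intro sum.cong refl sum.inter_filter[symmetric]) simp
  finally show ?thesis .
qed

end

section \<open>The associated graded module of a quotient\<close>

text \<open>A module \<open>M\<close> with a filtration \<open>F\<close> and a subspace \<open>K\<close> stable under \<open>g\<close>; the quotient \<open>M/K\<close> carries the induced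
  filtration. Its graded module consists of cosets of cosets. Everything is lifted to sequences in
  \<open>M\<close>: an element of the graded module is the image \<open>to_gr v\<close> of a sequence \<open>v\<close> with \<open>v i \<in> F i\<close>, the Lie
  algebra acts on sequences by \<open>shift\<close>, and \<open>to_gr v\<close> vanishes as soon as \<open>v i \<in> F (i - 1) + K\<close> for all \<open>i\<close>.\<close>

locale filtered_quotient = lie_module sc br scM \<rho>
  for sc :: "complex \<Rightarrow> 'a::ab_group_add \<Rightarrow> 'a" and br
    and scM :: "complex \<Rightarrow> 'm::ab_group_add \<Rightarrow> 'm" and \<rho> +
  fixes g :: "'a set" and K :: "'m set" and F :: "nat \<Rightarrow> 'm set"
  assumes subspace_g: "subspace g"
    and subspace_K: "M.subspace K" and stable_K: "\<And>Z v. Z \<in> g \<Longrightarrow> v \<in> K \<Longrightarrow> \<rho> Z v \<in> K"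
    and subspace_F: "\<And>i. M.subspace (F i)"
    and step_F: "\<And>Z v i. v \<in> F i \<Longrightarrow> \<rho> Z v \<in> F (Suc i)"
begin

sublocale subspace_of sc g by unfold_locales (rule subspace_g)

definition cls :: "'m \<Rightarrow> 'm set" where "cls v = K +>\<^bsub>space_of scM\<^esub> v"

definition quot :: "(complex, 'm set) module" where "quot = quotient_space (space_of scM) K"

definition quot_filtration :: "nat \<Rightarrow> 'm set set" where "quot_filtration i = cls ` F i"

definition prevF :: "nat \<Rightarrow> 'm set" where "prevF i = prev_step 0 F i"

definition quot_act :: "'a \<Rightarrow> 'm set \<Rightarrow> 'm set" where "quot_act Z = quotient_map (space_of scM) K (\<rho> Z)"

lemma prevF_simps [simp]: "prevF 0 = {0}" "prevF (Suc i) = F i"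
  by (simp_all add: prevF_def prev_step_def)

lemma subspace_prevF: "M.subspace (prevF i)"
  by (cases i) (auto simp: subspace_F M.subspace_0 M.subspace_def[of "{0}"])

lemma cls_eq: "cls v = {h + v | h. h \<in> K}"
  by (auto simp: cls_def a_r_coset_def' space_of_def)

lemma cls_eqI: "u - v \<in> K \<Longrightarrow> cls u = cls v"
proof -
  have *: "cls u \<subseteq> cls v" if "u - v \<in> K" for u v
  proof
    fix x assume "x \<in> cls u"
    then obtain h where "h \<in> K" "x = h + u" by (auto simp: cls_eq)
    then have "h + (u - v) \<in> K" "x = (h + (u - v)) + v"
      using that M.subspace_add[OF subspace_K] by auto
    then show "x \<in> cls v" unfolding cls_eq by blast
  qed
  assume "u - v \<in> K"
  moreover from this have "v - u \<in> K" using M.subspace_neg[OF subspace_K] by fastforce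
  ultimately show ?thesis using * by blast
qed

lemma quot_simps: "add quot = (<+>\<^bsub>space_of scM\<^esub>)" "zero quot = K"
  "smult quot c = quotient_map (space_of scM) K (scM c)"
  by (simp_all add: quot_def quotient_space_def) (simp add: space_of_def)

lemma cls_0: "cls 0 = K" by (auto simp: cls_eq)

lemma cls_add: "cls u \<oplus>\<^bsub>quot\<^esub> cls v = cls (u + v)"
proof -
  have "cls u \<oplus>\<^bsub>quot\<^esub> cls v = {a + b | a b. a \<in> cls u \<and> b \<in> cls v}"
    by (auto simp: quot_simps set_add_def' space_of_def)
  also have "\<dots> = cls (u + v)"
  proof safe
    fix a b assume "a \<in> cls u" "b \<in> cls v"
    then obtain h1 h2 where "h1 \<in> K" "h2 \<in> K" "a = h1 + u" "b = h2 + v" by (auto simp: cls_eq)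
    then have "h1 + h2 \<in> K" "a + b = (h1 + h2) + (u + v)"
      using M.subspace_add[OF subspace_K] by (auto simp: algebra_simps)
    then show "a + b \<in> cls (u + v)" unfolding cls_eq by blast
  next
    fix x assume "x \<in> cls (u + v)"
    then obtain h where "h \<in> K" "x = (h + u) + (0 + v)" by (auto simp: cls_eq algebra_simps)
    then show "\<exists>a b. x = a + b \<and> a \<in> cls u \<and> b \<in> cls v"
      using M.subspace_0[OF subspace_K] unfolding cls_eq by blast
  qed
  finally show ?thesis .
qed

lemma quotient_map_cls:
  assumes "\<And>u v. h (u + v) = h u + h v" "\<And>u. u \<in> K \<Longrightarrow> h u \<in> K"
  shows "quotient_map (space_of scM) K h (cls v) = cls (h v)"
  unfolding quotient_map_def
proof (rule the_elem_constant_image)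
  show "cls v \<noteq> {}" using M.subspace_0[OF subspace_K] by (auto simp: cls_eq)
  fix x assume "x \<in> cls v"
  then obtain k where "k \<in> K" "x = k + v" by (auto simp: cls_eq)
  then show "K +>\<^bsub>space_of scM\<^esub> h x = cls (h v)"
    unfolding cls_def[symmetric] using assms by (intro cls_eqI) simp
qed

lemma cls_scale: "c \<odot>\<^bsub>quot\<^esub> cls v = cls (scM c v)"
  unfolding quot_simps
  by (rule quotient_map_cls) (auto simp: M.scale_right_distrib M.subspace_scale[OF subspace_K])

lemma quot_act_cls: "Z \<in> g \<Longrightarrow> quot_act Z (cls v) = cls (\<rho> Z v)"
  unfolding quot_act_def by (rule quotient_map_cls) (auto simp: Act.op_add stable_K)

text \<open>The class of \<open>v \<in> F i\<close> in \<open>F i / F (i - 1)\<close> for the induced filtration of the quotient by \<open>K\<close>.\<close>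

definition gcls :: "nat \<Rightarrow> 'm \<Rightarrow> 'm set set" where "gcls i v = (\<lambda>u. cls (u + v)) ` prevF i"

lemma prev_step_quot: "prev_step \<zero>\<^bsub>quot\<^esub> quot_filtration i = cls ` prevF i"
  by (cases i) (auto simp: prev_step_def quot_simps cls_0 quot_filtration_def)

lemma quot_coset: "(cls ` S) +>\<^bsub>quot\<^esub> cls v = (\<lambda>u. cls (u + v)) ` S"
  by (auto simp: a_r_coset_def' cls_add)

lemma gcls_eqI:
  assumes "u - v = f + h" "f \<in> prevF i" "h \<in> K"
  shows "gcls i u = gcls i v"
proof -
  have *: "gcls i u \<subseteq> gcls i v" if uv: "u - v = f + h" "f \<in> prevF i" "h \<in> K" for u v f h
  proof
    fix x assume "x \<in> gcls i u"
    then obtain e where e: "e \<in> prevF i" "x = cls (e + u)" by (auto simp: gcls_def)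
    have "e + f \<in> prevF i" using e uv M.subspace_add[OF subspace_prevF] by blast
    moreover have "cls (e + u) = cls ((e + f) + v)"
    proof (rule cls_eqI)
      have "e + u - (e + f + v) = u - v - f" by (simp add: algebra_simps)
      then show "e + u - (e + f + v) \<in> K" using uv by simp
    qed
    ultimately show "x \<in> gcls i v" using e by (auto simp: gcls_def)
  qed
  have "v - u = - f + - h" using assms(1) by (simp add: algebra_simps eq_diff_eq)
  moreover have "- f \<in> prevF i" "- h \<in> K"
    using assms M.subspace_neg[OF subspace_prevF] M.subspace_neg[OF subspace_K] by auto
  ultimately show ?thesis using *[OF assms] * by blast
qed

lemma gr_piece_simps:
  "carrier (gr_piece quot quot_filtration i) = gcls i ` F i"
  "zero (gr_piece quot quot_filtration i) = gcls i 0"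
  "gcls i u \<oplus>\<^bsub>gr_piece quot quot_filtration i\<^esub> gcls i v = gcls i (u + v)"
  "c \<odot>\<^bsub>gr_piece quot quot_filtration i\<^esub> gcls i v = gcls i (scM c v)"
proof -
  show "carrier (gr_piece quot quot_filtration i) = gcls i ` F i"
    by (auto simp: gr_piece_def quotient_space_def A_RCOSETS_def' quot_filtration_def prev_step_quot
        quot_coset[unfolded a_r_coset_def'] gcls_def a_r_coset_def' cls_add)
  show "zero (gr_piece quot quot_filtration i) = gcls i 0"
    by (simp add: gr_piece_def quotient_space_def prev_step_quot gcls_def)
  have "gcls i u \<oplus>\<^bsub>gr_piece quot quot_filtration i\<^esub> gcls i v = {a \<oplus>\<^bsub>quot\<^esub> b | a b. a \<in> gcls i u \<and> b \<in> gcls i v}"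
    by (auto simp: gr_piece_def quotient_space_def set_add_def')
  also have "\<dots> = gcls i (u + v)"
  proof safe
    fix a b assume "a \<in> gcls i u" "b \<in> gcls i v"
    then obtain f h where fh: "f \<in> prevF i" "h \<in> prevF i" "a = cls (f + u)" "b = cls (h + v)"
      by (auto simp: gcls_def)
    then have "f + h \<in> prevF i" "a \<oplus>\<^bsub>quot\<^esub> b = cls ((f + h) + (u + v))"
      using M.subspace_add[OF subspace_prevF] by (auto simp: cls_add algebra_simps)
    then show "a \<oplus>\<^bsub>quot\<^esub> b \<in> gcls i (u + v)" unfolding gcls_def by blast
  next
    fix x assume "x \<in> gcls i (u + v)"
    then obtain e where "e \<in> prevF i" "x = cls (e + u) \<oplus>\<^bsub>quot\<^esub> cls (0 + v)"
      by (auto simp: gcls_def cls_add algebra_simps)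
    then show "\<exists>a b. x = a \<oplus>\<^bsub>quot\<^esub> b \<and> a \<in> gcls i u \<and> b \<in> gcls i v"
      using M.subspace_0[OF subspace_prevF] unfolding gcls_def by blast
  qed
  finally show "gcls i u \<oplus>\<^bsub>gr_piece quot quot_filtration i\<^esub> gcls i v = gcls i (u + v)" .
  have "(cls ` prevF i) +>\<^bsub>quot\<lparr>carrier := quot_filtration i\<rparr>\<^esub> x = (cls ` prevF i) +>\<^bsub>quot\<^esub> x" for x
    by (simp add: a_r_coset_def')
  then have "c \<odot>\<^bsub>gr_piece quot quot_filtration i\<^esub> gcls i v =
      the_elem ((\<lambda>x. (cls ` prevF i) +>\<^bsub>quot\<^esub> (c \<odot>\<^bsub>quot\<^esub> x)) ` gcls i v)"
    by (simp add: gr_piece_def quotient_space_def quotient_map_def prev_step_quot)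
  also have "\<dots> = gcls i (scM c v)"
  proof (rule the_elem_constant_image)
    show "gcls i v \<noteq> {}" using M.subspace_0[OF subspace_prevF] by (auto simp: gcls_def)
    fix x assume "x \<in> gcls i v"
    then obtain u where u: "u \<in> prevF i" "x = cls (u + v)" by (auto simp: gcls_def)
    have "(cls ` prevF i) +>\<^bsub>quot\<^esub> (c \<odot>\<^bsub>quot\<^esub> x) = gcls i (scM c (u + v))"
      unfolding u(2) cls_scale quot_coset gcls_def ..
    also have "\<dots> = gcls i (scM c v)"
      using u(1) M.subspace_scale[OF subspace_prevF] M.subspace_0[OF subspace_K]
      by (intro gcls_eqI[where f = "scM c u" and h = 0]) (auto simp: M.scale_right_distrib)
    finally show "(cls ` prevF i) +>\<^bsub>quot\<^esub> (c \<odot>\<^bsub>quot\<^esub> x) = gcls i (scM c v)" .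
  qed
  finally show "c \<odot>\<^bsub>gr_piece quot quot_filtration i\<^esub> gcls i v = gcls i (scM c v)" .
qed

definition lifts :: "(nat \<Rightarrow> 'm) set" where "lifts = {v. (\<forall>i. v i \<in> F i) \<and> finite {i. v i \<noteq> 0}}"

definition to_gr :: "(nat \<Rightarrow> 'm) \<Rightarrow> nat \<Rightarrow> 'm set set" where "to_gr v = (\<lambda>i. gcls i (v i))"

definition shift :: "'a \<Rightarrow> (nat \<Rightarrow> 'm) \<Rightarrow> nat \<Rightarrow> 'm"
  where "shift Z v = (\<lambda>i. case i of 0 \<Rightarrow> 0 | Suc j \<Rightarrow> \<rho> Z (v j))"

abbreviation seq_scale :: "complex \<Rightarrow> (nat \<Rightarrow> 'm) \<Rightarrow> nat \<Rightarrow> 'm" where "seq_scale c v \<equiv> (\<lambda>i. scM c (v i))"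

sublocale Seq: operator_family seq_scale shift
  by unfold_locales
    (auto simp: fun_eq_iff shift_def M.scale_right_distrib M.scale_left_distrib Act.op_add
      Act.op_scale split: nat.split)

lemma subspace_lifts: "Seq.subspace lifts"
  unfolding Seq.subspace_def
proof (intro conjI ballI allI)
  show "0 \<in> lifts" by (simp add: lifts_def M.subspace_0[OF subspace_F])
  fix v assume v: "v \<in> lifts"
  { fix w assume "w \<in> lifts"
    moreover have "{i. v i + w i \<noteq> 0} \<subseteq> {i. v i \<noteq> 0} \<union> {i. w i \<noteq> 0}" by auto
    ultimately show "v + w \<in> lifts"
      using v by (auto simp: lifts_def M.subspace_add[OF subspace_F] intro: finite_subset) }
  fix c
  have "{i. scM c (v i) \<noteq> 0} \<subseteq> {i. v i \<noteq> 0}" by auto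
  then show "seq_scale c v \<in> lifts"
    using v by (auto simp: lifts_def M.subspace_scale[OF subspace_F] intro: finite_subset)
qed

lemma shift_lifts: "v \<in> lifts \<Longrightarrow> shift Z v \<in> lifts"
proof -
  assume v: "v \<in> lifts"
  have "{i. shift Z v i \<noteq> 0} \<subseteq> Suc ` {i. v i \<noteq> 0}"
  proof
    fix i assume "i \<in> {i. shift Z v i \<noteq> 0}"
    then obtain j where "i = Suc j" "\<rho> Z (v j) \<noteq> 0" by (cases i) (auto simp: shift_def)
    then have "i = Suc j" "v j \<noteq> 0" by auto
    then show "i \<in> Suc ` {i. v i \<noteq> 0}" by simp
  qed
  then have "finite {i. shift Z v i \<noteq> 0}"
    by (rule finite_subset) (use v in \<open>auto simp: lifts_def\<close>)
  moreover have "shift Z v i \<in> F i" for i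
    using v by (cases i) (auto simp: shift_def lifts_def step_F M.subspace_0[OF subspace_F])
  ultimately show ?thesis by (simp add: lifts_def)
qed

lemma gr_space_simps:
  "carrier (gr_space quot quot_filtration) = to_gr ` lifts"
  "zero (gr_space quot quot_filtration) = to_gr 0"
  "to_gr u \<oplus>\<^bsub>gr_space quot quot_filtration\<^esub> to_gr v = to_gr (u + v)"
  "c \<odot>\<^bsub>gr_space quot quot_filtration\<^esub> to_gr v = to_gr (seq_scale c v)"
proof -
  show "zero (gr_space quot quot_filtration) = to_gr 0"
    by (simp add: gr_space_def gr_piece_simps to_gr_def)
  show "to_gr u \<oplus>\<^bsub>gr_space quot quot_filtration\<^esub> to_gr v = to_gr (u + v)"
    by (simp add: gr_space_def gr_piece_simps to_gr_def)
  show "c \<odot>\<^bsub>gr_space quot quot_filtration\<^esub> to_gr v = to_gr (seq_scale c v)"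
    by (simp add: gr_space_def gr_piece_simps to_gr_def)
  show "carrier (gr_space quot quot_filtration) = to_gr ` lifts"
  proof safe
    fix x assume "x \<in> carrier (gr_space quot quot_filtration)"
    then have x: "\<And>i. x i \<in> gcls i ` F i" and fin: "finite {i. x i \<noteq> gcls i 0}"
      by (auto simp: gr_space_def gr_piece_simps)
    \<comment> \<open>Zero is chosen as the lift wherever possible, to keep the support finite.\<close>
    have "\<exists>v. v \<in> F i \<and> x i = gcls i v \<and> (x i = gcls i 0 \<longrightarrow> v = 0)" for i
      using x[of i] M.subspace_0[OF subspace_F] by (cases "x i = gcls i 0") auto
    then obtain v where v: "\<And>i. v i \<in> F i \<and> x i = gcls i (v i) \<and> (x i = gcls i 0 \<longrightarrow> v i = 0)"
      by metis
    then have "{i. v i \<noteq> 0} \<subseteq> {i. x i \<noteq> gcls i 0}" by auto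
    then have "v \<in> lifts" using v fin finite_subset by (auto simp: lifts_def)
    moreover have "x = to_gr v" using v by (auto simp: to_gr_def)
    ultimately show "x \<in> to_gr ` lifts" by blast
  next
    fix v assume "v \<in> lifts"
    moreover have "{i. gcls i (v i) \<noteq> gcls i 0} \<subseteq> {i. v i \<noteq> 0}" by auto
    ultimately show "to_gr v \<in> carrier (gr_space quot quot_filtration)"
      by (auto simp: gr_space_def gr_piece_simps lifts_def to_gr_def intro: finite_subset)
  qed
qed

lemma gr_act_to_gr:
  assumes "Z \<in> g"
  shows "gr_act quot quot_filtration quot_act Z (to_gr v) = to_gr (shift Z v)"
proof
  fix i
  show "gr_act quot quot_filtration quot_act Z (to_gr v) i = to_gr (shift Z v) i"
  proof (cases i)
    case 0
    then show ?thesis by (simp add: gr_act_def to_gr_def shift_def gr_piece_simps)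
  next
    case (Suc j)
    have "the_elem ((\<lambda>A. quot_filtration j +>\<^bsub>quot\<^esub> quot_act Z A) ` gcls j (v j)) = gcls i (\<rho> Z (v j))"
    proof (rule the_elem_constant_image)
      show "gcls j (v j) \<noteq> {}" using M.subspace_0[OF subspace_prevF] by (auto simp: gcls_def)
      fix A assume "A \<in> gcls j (v j)"
      then obtain u where u: "u \<in> prevF j" "A = cls (u + v j)" by (auto simp: gcls_def)
      have "\<rho> Z u \<in> F j" using u(1) step_F M.subspace_0[OF subspace_F] by (cases j) auto
      then have "gcls i (\<rho> Z (u + v j)) = gcls i (\<rho> Z (v j))"
        using Suc M.subspace_0[OF subspace_K]
        by (intro gcls_eqI[where f = "\<rho> Z u" and h = 0]) (auto simp: Act.op_add)
      moreover have "quot_filtration j +>\<^bsub>quot\<^esub> quot_act Z A = gcls i (\<rho> Z (u + v j))"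
        unfolding u(2) quot_act_cls[OF assms] quot_filtration_def quot_coset gcls_def using Suc by simp
      ultimately show "quot_filtration j +>\<^bsub>quot\<^esub> quot_act Z A = gcls i (\<rho> Z (v j))" by simp
    qed
    then show ?thesis
      using Suc by (simp add: gr_act_def to_gr_def shift_def quotient_map_def)
  qed
qed

lemma free_act_to_gr:
  assumes p: "p \<in> carrier (free_ring g)" and v: "v \<in> lifts"
  shows "free_act (gr_space quot quot_filtration) (gr_act quot quot_filtration quot_act) p (to_gr v) = to_gr (poly_act seq_scale shift p v)"
proof -
  interpret G: abelian_monoid "gr_space quot quot_filtration"
    by (rule abelian_monoidI)
      (auto simp: gr_space_simps Seq.subspace_add[OF subspace_lifts] Seq.subspace_0[OF subspace_lifts] ac_simps)
  have sum: "finsum (gr_space quot quot_filtration) (\<lambda>w. to_gr (h w)) A = to_gr (\<Sum>w\<in>A. h w)"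
    if "finite A" "\<And>w. w \<in> A \<Longrightarrow> h w \<in> lifts" for h and A :: "'a fword set"
    using that
  proof (induction A)
    case (insert w A)
    then have "finsum (gr_space quot quot_filtration) (\<lambda>w. to_gr (h w)) (insert w A) =
        to_gr (h w) \<oplus>\<^bsub>gr_space quot quot_filtration\<^esub> finsum (gr_space quot quot_filtration) (\<lambda>w. to_gr (h w)) A"
      by (intro G.finsum_insert) (auto simp: gr_space_simps)
    then show ?case using insert by (simp add: gr_space_simps plus_fun_def)
  qed (simp add: gr_space_simps)
  have word: "foldr (gr_act quot quot_filtration quot_act) w (to_gr v) = to_gr (foldr shift w v) \<and> foldr shift w v \<in> lifts"
    if "set w \<subseteq> g" for w
    using that by (induction w) (auto simp: gr_act_to_gr shift_lifts v)
  let ?h = "\<lambda>w. seq_scale (Poly_Mapping.lookup p w) (foldr shift (letters w) v)"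
  have w: "set (letters w) \<subseteq> g" if "w \<in> Poly_Mapping.keys p" for w
    using p that by (simp add: in_carrier_free_ring)
  have "free_act (gr_space quot quot_filtration) (gr_act quot quot_filtration quot_act) p (to_gr v) =
      finsum (gr_space quot quot_filtration) (\<lambda>w. to_gr (?h w)) (Poly_Mapping.keys p)"
    unfolding free_act_def
  proof (rule G.finsum_cong')
    show "(\<lambda>w. to_gr (?h w)) \<in> Poly_Mapping.keys p \<rightarrow> carrier (gr_space quot quot_filtration)"
      using word[OF w] Seq.subspace_scale[OF subspace_lifts] by (auto simp: gr_space_simps)
  qed (use word[OF w] in \<open>simp_all add: gr_space_simps\<close>)
  also have "\<dots> = to_gr (\<Sum>w\<in>Poly_Mapping.keys p. ?h w)"
    using word[OF w] Seq.subspace_scale[OF subspace_lifts] by (intro sum) auto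
  finally show ?thesis by (simp add: poly_act_def)
qed

definition null_lifts :: "(nat \<Rightarrow> 'm) set"
  where "null_lifts = {v. \<forall>i. \<exists>f\<in>prevF i. \<exists>h\<in>K. v i = f + h}"

lemma to_gr_null_lift: "v \<in> null_lifts \<Longrightarrow> to_gr v = to_gr 0"
proof
  fix i assume "v \<in> null_lifts"
  then obtain f h where "f \<in> prevF i" "h \<in> K" "v i = f + h"
    unfolding null_lifts_def by blast
  then show "to_gr v i = to_gr 0 i"
    unfolding to_gr_def by (intro gcls_eqI) auto
qed

lemma subspace_null_lifts: "Seq.subspace null_lifts"
  unfolding Seq.subspace_def
proof (intro conjI ballI allI)
  show "0 \<in> null_lifts"
    using M.subspace_0[OF subspace_prevF] M.subspace_0[OF subspace_K] by (force simp: null_lifts_def)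
  fix v assume v: "v \<in> null_lifts"
  { fix w assume w: "w \<in> null_lifts"
    show "v + w \<in> null_lifts"
      unfolding null_lifts_def
    proof safe
      fix i
      obtain f h f' h' where "f \<in> prevF i" "h \<in> K" "v i = f + h" "f' \<in> prevF i" "h' \<in> K" "w i = f' + h'"
        using v w unfolding null_lifts_def by blast
      then show "\<exists>f\<in>prevF i. \<exists>h\<in>K. (v + w) i = f + h"
        using M.subspace_add[OF subspace_prevF] M.subspace_add[OF subspace_K]
        by (intro bexI[of _ "f + f'"] bexI[of _ "h + h'"]) (auto simp: algebra_simps)
    qed }
  fix c
  show "seq_scale c v \<in> null_lifts"
    unfolding null_lifts_def
  proof safe
    fix i
    obtain f h where "f \<in> prevF i" "h \<in> K" "v i = f + h" using v unfolding null_lifts_def by blast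
    then show "\<exists>f\<in>prevF i. \<exists>h\<in>K. scM c (v i) = f + h"
      using M.subspace_scale[OF subspace_prevF] M.subspace_scale[OF subspace_K]
      by (intro bexI[of _ "scM c f"] bexI[of _ "scM c h"]) (auto simp: M.scale_right_distrib)
  qed
qed

lemma shift_null_lifts:
  assumes "Z \<in> g" "v \<in> null_lifts"
  shows "shift Z v \<in> null_lifts"
  unfolding null_lifts_def
proof safe
  fix i
  show "\<exists>f\<in>prevF i. \<exists>h\<in>K. shift Z v i = f + h"
  proof (cases i)
    case 0
    then show ?thesis using M.subspace_0[OF subspace_K] by (simp add: shift_def)
  next
    case (Suc j)
    obtain f h where fh: "f \<in> prevF j" "h \<in> K" "v j = f + h" using assms(2) unfolding null_lifts_def by blast
    moreover have "\<rho> Z f \<in> F j" using fh step_F M.subspace_0[OF subspace_F] by (cases j) auto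
    ultimately show ?thesis
      using Suc stable_K[OF assms(1)]
      by (intro bexI[of _ "\<rho> Z f"] bexI[of _ "\<rho> Z h"]) (auto simp: shift_def Act.op_add)
  qed
qed

text \<open>A commutator acts on sequences by \<open>\<rho> (br x y)\<close> in degree two. But \<open>\<rho> (br x y)\<close> raises the filtration by
  one only, so the result is null: this is why the graded module is a module over the symmetric
  algebra.\<close>

lemma sym_ideal_null_lifts:
  assumes h: "h \<in> sym_ideal sc g" and v: "v \<in> lifts"
  shows "poly_act seq_scale shift h v \<in> null_lifts"
proof (rule Seq.act_ideal[OF subspace_lifts _ subspace_null_lifts shift_null_lifts _ _ _ v, where g = g])
  fix p :: "'a free_algebra" and v
  assume p: "p \<in> linear_rels sc g \<union> {gen x * gen y - gen y * gen x |x y. x \<in> g \<and> y \<in> g}"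
    and v: "v \<in> lifts"
  have shift_add: "shift (x + y) v = shift x v + shift y v"
    and shift_scale: "shift (sc c x) v = seq_scale c (shift x v)" for x y c
    by (auto simp: fun_eq_iff shift_def action_add_left action_scale_left split: nat.split)
  from p consider "p \<in> linear_rels sc g"
    | x y where "p = gen x * gen y - gen y * gen x" by auto
  then show "poly_act seq_scale shift p v \<in> null_lifts"
  proof cases
    case 1
    then have "poly_act seq_scale shift p v = 0"
      by (auto simp: linear_rels_def Seq.act_diff shift_add shift_scale fun_eq_iff)
    then show ?thesis using Seq.subspace_0[OF subspace_null_lifts] by simp
  next
    case 2
    have "poly_act seq_scale shift p v = shift x (shift y v) - shift y (shift x v)"
      unfolding 2 gen_mult Seq.act_diff by (simp add: fun_eq_iff)
    also have "\<dots> \<in> null_lifts"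
      unfolding null_lifts_def
    proof safe
      fix i
      show "\<exists>f\<in>prevF i. \<exists>h\<in>K. (shift x (shift y v) - shift y (shift x v)) i = f + h"
      proof (cases "i < 2")
        case True
        then have "(shift x (shift y v) - shift y (shift x v)) i = 0 + 0"
          by (cases i) (auto simp: shift_def)
        then show ?thesis
          using M.subspace_0[OF subspace_prevF] M.subspace_0[OF subspace_K] by metis
      next
        case False
        then obtain j where j: "i = Suc (Suc j)" by (metis less_2_cases_iff not0_implies_Suc One_nat_def)
        have "(shift x (shift y v) - shift y (shift x v)) i = \<rho> (br x y) (v j) + 0"
          by (simp add: j shift_def action_bracket)
        moreover have "\<rho> (br x y) (v j) \<in> prevF i" using v step_F by (simp add: j lifts_def)
        ultimately show ?thesis using M.subspace_0[OF subspace_K] by metis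
      qed
    qed
    finally show ?thesis .
  qed
qed (use h linear_rels_carrier commutators_carrier in \<open>auto simp: sym_ideal_def shift_lifts\<close>)

text \<open>For homogeneous \<open>P\<close>, entry \<open>i\<close> of the result is the value of \<open>P\<close> on the single entry \<open>i - n\<close>, and so lies in
  \<open>K\<close>. For inhomogeneous \<open>P\<close> the homogeneous parts would act on different entries, and nothing could
  be concluded.\<close>

lemma homogeneous_act_null_lifts:
  assumes deg: "\<And>w. w \<in> Poly_Mapping.keys P \<Longrightarrow> length (letters w) = n"
    and P: "\<And>v. poly_act scM \<rho> P v \<in> K"
  shows "poly_act seq_scale shift P v \<in> null_lifts"
proof -
  have word: "foldr shift w v i = (if length w \<le> i then foldr \<rho> w (v (i - length w)) else 0)" for w i
    by (induction w arbitrary: i) (auto simp: shift_def split: nat.split)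
  have app: "(\<Sum>w\<in>A. h w) i = (\<Sum>w\<in>A. h w i)" for h :: "'a fword \<Rightarrow> nat \<Rightarrow> 'm" and A i
    by (induction A rule: infinite_finite_induct) auto
  have "poly_act seq_scale shift P v i = (if n \<le> i then poly_act scM \<rho> P (v (i - n)) else 0)" for i
    unfolding poly_act_def app word using deg by (auto intro!: sum.cong sum.neutral)
  then have "poly_act seq_scale shift P v i \<in> K" for i
    using P M.subspace_0[OF subspace_K] by simp
  then show ?thesis
    using M.subspace_0[OF subspace_prevF] unfolding null_lifts_def
    by (auto intro!: bexI[where A = "prevF _" and x = 0])
qed

theorem homogeneous_in_annihilator:
  assumes carrier: "P \<in> carrier (free_ring g)"
    and deg: "\<And>w. w \<in> Poly_Mapping.keys P \<Longrightarrow> length (letters w) = n"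
    and P: "\<And>v. poly_act scM \<rho> P v \<in> K"
  shows "sym_class sc g P \<in> annihilator (Sym sc g) (gr_module quot quot_filtration quot_act)"
proof -
  have "sym_class sc g P \<in> carrier (Sym sc g)"
    using ring_hom_closed[OF ideal.rcos_ring_hom[OF ideal_sym_ideal] carrier]
    by (simp add: Sym_def sym_class_def)
  moreover have "sym_class sc g P \<odot>\<^bsub>gr_module quot quot_filtration quot_act\<^esub> x = \<zero>\<^bsub>gr_module quot quot_filtration quot_act\<^esub>"
    if x: "x \<in> carrier (gr_module quot quot_filtration quot_act)" for x
  proof -
    obtain v where v: "v \<in> lifts" "x = to_gr v" using x by (auto simp: gr_module_def gr_space_simps)
    have "the_elem ((\<lambda>p. free_act (gr_space quot quot_filtration) (gr_act quot quot_filtration quot_act) p x) ` sym_class sc g P) = to_gr 0"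
      unfolding sym_class_def free_coset
    proof (rule the_elem_constant_image)
      show "{h + P |h. h \<in> sym_ideal sc g} \<noteq> {}"
        using zero_in_ideal[OF ideal_sym_ideal] by auto
      fix p assume "p \<in> {h + P |h. h \<in> sym_ideal sc g}"
      then obtain h where h: "h \<in> sym_ideal sc g" "p = h + P" by auto
      have hc: "h \<in> carrier (free_ring g)"
        using h ideal_sym_ideal additive_subgroup.a_Hcarr ideal.axioms(1) by metis
      have "free_act (gr_space quot quot_filtration) (gr_act quot quot_filtration quot_act) p x = to_gr (poly_act seq_scale shift p v)"
        unfolding v(2) h(2) by (intro free_act_to_gr add_in_free_ring hc carrier v)
      also have "\<dots> = to_gr 0"
        unfolding h(2) Seq.act_add
        by (intro to_gr_null_lift Seq.subspace_add[OF subspace_null_lifts] sym_ideal_null_lifts h v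
            homogeneous_act_null_lifts[OF deg P])
      finally show "free_act (gr_space quot quot_filtration) (gr_act quot quot_filtration quot_act) p x = to_gr 0" .
    qed
    then show ?thesis by (simp add: gr_module_def gr_space_simps)
  qed
  ultimately show ?thesis by (simp add: annihilator_def)
qed

end

section \<open>Words of nonnegative excess modulo the coinvariant kernel\<close>

text \<open>The weight \<open>(1,-1)\<close> has to be absent because the bracket with an element of weight \<open>(0,1)\<close> would carry it to
  the weight \<open>(1,0)\<close>, where \<open>\<xi>\<close> need not vanish; see \<open>wt01_in_G\<close>.\<close>

locale coinvariant_setting = weight_basis sc br X Y B wx wy + lie_module sc br scM \<rho>
  for sc :: "complex \<Rightarrow> 'a::ab_group_add \<Rightarrow> 'a" and br X Y B wx wy
    and scM :: "complex \<Rightarrow> 'm::ab_group_add \<Rightarrow> 'm" and \<rho> +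
  fixes \<xi> :: "'a \<Rightarrow> complex"
  assumes wt_narrow: "j \<notin> {-1, 0, 1} \<Longrightarrow> weight_space sc br X Y i j = {0}"
    and wt_corner: "weight_space sc br X Y 1 (-1) = {0}"
    and \<xi>_dual: "\<xi> \<in> dual_space sc (upper_part sc br X Y 1)"
    and \<xi>_vanish: "i \<ge> 1 \<Longrightarrow> (i, j) \<noteq> (1, 0) \<Longrightarrow> Z \<in> weight_space sc br X Y i j \<Longrightarrow> \<xi> Z = 0"
begin

abbreviation N :: "'a set" where "N \<equiv> upper_part sc br X Y 1"

abbreviation K :: "'m set" where "K \<equiv> coinv_kernel scM \<rho> N \<xi>"

abbreviation G :: "'a set" where "G \<equiv> stabilizer0 sc br X Y \<xi>"

lemma subspace_N: "subspace N" by (simp add: upper_part_def)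

lemma wt_in_N: "i \<ge> 1 \<Longrightarrow> wt i j \<subseteq> N"
proof
  fix Z assume "i \<ge> 1" "Z \<in> wt i j"
  moreover from this have "Z \<in> graded_part sc br X Y i"
    unfolding graded_part_def by (intro span_base) auto
  ultimately show "Z \<in> N" unfolding upper_part_def by (intro span_base) auto
qed

text \<open>The ideal of positive degree is spanned directly by weight vectors.\<close>

lemma N_minimal:
  assumes S: "subspace S" and wt: "\<And>i j Z. i \<ge> 1 \<Longrightarrow> Z \<in> wt i j \<Longrightarrow> Z \<in> S"
  shows "N \<subseteq> S"
  unfolding upper_part_def
proof (rule span_minimal[OF _ S], rule UN_least)
  fix i :: int assume "i \<in> {1..}"
  then show "graded_part sc br X Y i \<subseteq> S"
    unfolding graded_part_def using wt by (intro span_minimal[OF _ S]) auto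
qed

lemma subspace_preimage: "subspace S \<Longrightarrow> subspace {W. br Z W \<in> S}"
  by (auto simp: subspace_def br_add_right br_scale_right)

lemma subspace_preimage_left: "subspace S \<Longrightarrow> subspace {W. br W Z \<in> S}"
  using br_add_left[of 0 0 Z] by (auto simp: subspace_def br_add_left br_scale_left)

lemma degree0_N: "Z \<in> graded_part sc br X Y 0 \<Longrightarrow> W \<in> N \<Longrightarrow> br Z W \<in> N"
proof -
  assume Z: "Z \<in> graded_part sc br X Y 0" and W: "W \<in> N"
  have "br Z W \<in> N" if Z: "Z \<in> wt 0 j" for Z j
  proof -
    have "N \<subseteq> {W. br Z W \<in> N}"
      by (rule N_minimal[OF subspace_preimage[OF subspace_N]])
        (use wt_bracket[OF Z] wt_in_N in fastforce)
    then show ?thesis using W by auto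
  qed
  then have "graded_part sc br X Y 0 \<subseteq> {Z. br Z W \<in> N}"
    unfolding graded_part_def
    by (intro span_minimal subspace_preimage_left subspace_N) auto
  then show ?thesis using Z by auto
qed

lemma \<xi>_add: "W \<in> N \<Longrightarrow> W' \<in> N \<Longrightarrow> \<xi> (W + W') = \<xi> W + \<xi> W'"
  and \<xi>_scale: "W \<in> N \<Longrightarrow> \<xi> (sc c W) = c * \<xi> W"
  using dual_space_linear[OF \<xi>_dual] by auto

lemma \<xi>_zero [simp]: "\<xi> 0 = 0"
  using \<xi>_scale[of 0 0] subspace_0[OF subspace_N] by simp

lemma subspace_G: "subspace G"
proof -
  have g: "subspace (graded_part sc br X Y 0)" by (simp add: graded_part_def)
  have z: "br 0 W = 0" for W using br_add_left[of 0 0 W] by simp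
  show ?thesis
    using subspace_0[OF g] subspace_add[OF g] subspace_scale[OF g] degree0_N
    by (auto simp: subspace_def stabilizer0_def z br_add_left br_scale_left \<xi>_add \<xi>_scale)
qed

lemma wt01_in_G: "wt 0 1 \<subseteq> G"
proof
  fix Z assume Z: "Z \<in> wt 0 1"
  have Z0: "Z \<in> graded_part sc br X Y 0"
    unfolding graded_part_def using Z by (intro span_base) auto
  let ?S = "{W \<in> N. \<xi> (br Z W) = 0}"
  have "N \<subseteq> ?S"
  proof (rule N_minimal)
    show "subspace ?S"
      using subspace_0[OF subspace_N] subspace_add[OF subspace_N] subspace_scale[OF subspace_N]
        degree0_N[OF Z0]
      by (auto simp: subspace_def br_add_right br_scale_right \<xi>_add \<xi>_scale)
    fix i j W assume i: "(i::int) \<ge> 1" and W: "W \<in> wt i j"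
    have "\<xi> (br Z W) = 0"
    proof (cases "i = 1 \<and> j = -1")
      case True
      then show ?thesis using W wt_corner by simp
    next
      case False
      then show ?thesis using \<xi>_vanish[of i "1 + j" "br Z W"] wt_bracket[OF Z W] i by auto
    qed
    then show "W \<in> ?S" using wt_in_N[OF i] W by auto
  qed
  then show "Z \<in> G" using Z0 by (auto simp: stabilizer0_def)
qed

lemma subspace_K: "M.subspace K" by (simp add: coinv_kernel_def)

lemma K_generator: "Z \<in> N \<Longrightarrow> \<rho> Z v - scM (\<xi> Z) v \<in> K"
  unfolding coinv_kernel_def by (intro M.span_base) auto

text \<open>Commuting \<open>Z\<close> past a generator for \<open>W\<close> gives a generator for \<open>W\<close> and one for \<open>br Z W\<close>, on which \<open>\<xi>\<close>
  vanishes by the definition of the stabilizer.\<close>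

lemma stable_K:
  assumes Z: "Z \<in> G" and v: "v \<in> K"
  shows "\<rho> Z v \<in> K"
proof -
  have "M.subspace {v. \<rho> Z v \<in> K}"
    using M.subspace_0[OF subspace_K] M.subspace_add[OF subspace_K] M.subspace_scale[OF subspace_K]
    by (auto simp: M.subspace_def Act.op_add Act.op_scale)
  moreover have "\<rho> Z (\<rho> W u - scM (\<xi> W) u) \<in> K" if W: "W \<in> N" for W u
  proof -
    have ZW: "br Z W \<in> N" "\<xi> (br Z W) = 0"
      using Z W degree0_N by (auto simp: stabilizer0_def)
    have "\<rho> Z (\<rho> W u - scM (\<xi> W) u) =
        (\<rho> W (\<rho> Z u) - scM (\<xi> W) (\<rho> Z u)) + (\<rho> (br Z W) u - scM (\<xi> (br Z W)) u)"
      by (simp add: Act.op_diff Act.op_scale action_bracket ZW)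
    then show ?thesis
      using M.subspace_add[OF subspace_K] K_generator[OF W] K_generator[OF ZW(1)] by simp
  qed
  ultimately have "K \<subseteq> {v. \<rho> Z v \<in> K}"
    unfolding coinv_kernel_def[of scM \<rho> N \<xi>] by (intro M.span_minimal) auto
  then show ?thesis using v by auto
qed

text \<open>In this section the letters of a word carry their weights along with them, since a bracket of
  weight vectors may be zero and then does not determine a weight.\<close>

definition weighted :: "((int \<times> int) \<times> 'a) list \<Rightarrow> bool"
  where "weighted w \<longleftrightarrow> (\<forall>l\<in>set w. snd l \<in> wt (fst (fst l)) (snd (fst l)))"

definition excess :: "((int \<times> int) \<times> 'a) list \<Rightarrow> int"
  where "excess w = (\<Sum>l\<leftarrow>w. fst (fst l) + snd (fst l) - 1)"

text \<open>A word is to act modulo \<open>K\<close> as \<open>scalar_part\<close> times the operator of the word \<open>operator_part\<close>.\<close>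

definition scalar_part :: "((int \<times> int) \<times> 'a) list \<Rightarrow> complex"
  where "scalar_part w = (\<Prod>l\<leftarrow>w. if fst l = (0, 1) then 1 else if fst l = (1, 0) then \<xi> (snd l) else 0)"

definition operator_part :: "((int \<times> int) \<times> 'a) list \<Rightarrow> 'a list"
  where "operator_part w = map snd (filter (\<lambda>l. fst l = (0, 1)) w)"

text \<open>A nonzero scalar part means that all letters have weight \<open>(0,1)\<close> or \<open>(1,0)\<close>, both of excess zero.\<close>

lemma scalar_part_nonzero:
  assumes "scalar_part w \<noteq> 0"
  shows "(\<Sum>l\<leftarrow>w. snd (fst l)) = int (length (operator_part w))"
    and "(\<Sum>l\<leftarrow>w. fst (fst l)) = int (length w) - int (length (operator_part w))"
    and "excess w = 0"
  using assms
  by (induction w) (auto simp: scalar_part_def operator_part_def excess_def split: if_splits)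

lemma word_zero_letter: "0 \<in> set w \<Longrightarrow> foldr \<rho> w v = 0"
proof (induction w)
  case (Cons z w)
  have "\<rho> 0 u = 0" for u using action_add_left[of 0 0 u] by simp
  with Cons show ?case by auto
qed simp

text \<open>Without letters of positive degree in \<open>X\<close>, nonnegative excess forces either all weights to be \<open>(0,1)\<close>, or
  some weight to have \<open>j \<ge> 2\<close>; in that case the letter is zero.\<close>

lemma word_mod_kernel_nonpositive:
  assumes w: "weighted w" and ex: "excess w \<ge> 0" and nonpos: "\<forall>l\<in>set w. fst (fst l) \<le> 0"
  shows "foldr \<rho> (map snd w) v - scM (scalar_part w) (foldr \<rho> (operator_part w) v) \<in> K"
proof (cases "\<forall>l\<in>set w. fst l = (0, 1)")
  case True
  then have "scalar_part w = 1 \<and> operator_part w = map snd w"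
    by (induction w) (auto simp: scalar_part_def operator_part_def)
  then show ?thesis using M.subspace_0[OF subspace_K] by simp
next
  case False
  have "\<exists>l\<in>set w. snd (fst l) \<ge> 2"
  proof (rule ccontr)
    \<comment> \<open>If \<open>j \<le> 1\<close> throughout, no letter has positive excess and a letter other than \<open>(0,1)\<close> has negative excess.\<close>
    assume none: "\<not> ?thesis"
    then have le: "fst (fst l) + snd (fst l) - 1 \<le> 0" if "l \<in> set w" for l
      using nonpos that by force
    obtain l where l: "l \<in> set w" "fst l \<noteq> (0, 1)" using False by blast
    have "fst (fst l) + snd (fst l) - 1 < 0"
      using l nonpos none by (cases "fst l") force
    moreover have "excess w \<le> fst (fst l) + snd (fst l) - 1"
    proof -
      obtain u u' where "w = u @ l # u'" using l split_list by metis
      moreover have "excess x \<le> 0" if "set x \<subseteq> set w" for x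
        using that le unfolding excess_def by (intro sum_list_nonpos) auto
      then have "excess u \<le> 0" "excess u' \<le> 0" using calculation by auto
      ultimately show ?thesis by (simp add: excess_def)
    qed
    ultimately show False using ex by simp
  qed
  then obtain l where l: "l \<in> set w" "snd (fst l) \<ge> 2" by blast
  then have "snd l = 0" using w wt_narrow[of "snd (fst l)" "fst (fst l)"] by (auto simp: weighted_def)
  then have "foldr \<rho> (map snd w) v = 0" using l by (intro word_zero_letter) force
  moreover have "scalar_part w = 0"
    unfolding scalar_part_def prod_list_zero_iff using l by force
  ultimately show ?thesis using M.subspace_0[OF subspace_K] by simp
qed

text \<open>Induction on the length, and for each length on the number of letters in front of a fixed letter \<open>l\<close>
  of positive degree in \<open>X\<close>. At the front, \<open>l\<close> acts as a scalar modulo \<open>K\<close>. Exchanging \<open>l\<close> with its left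
  neighbour changes neither the scalar nor the operator part (\<open>l\<close> does not have weight \<open>(0,1)\<close>), and adds
  a word in which both are replaced by their bracket. This word is shorter and has excess larger by
  one, so its scalar part is zero and the induction hypothesis puts its values into \<open>K\<close>.\<close>

lemma word_mod_kernel:
  assumes "weighted w" and "excess w \<ge> 0"
  shows "foldr \<rho> (map snd w) v - scM (scalar_part w) (foldr \<rho> (operator_part w) v) \<in> K"
  using assms
proof (induction "length w" arbitrary: w v rule: less_induct)
  case less
  have front: "foldr \<rho> (map snd (w1 @ l # w2)) v -
      scM (scalar_part (w1 @ l # w2)) (foldr \<rho> (operator_part (w1 @ l # w2)) v) \<in> K"
    if "length (w1 @ l # w2) = length w" "weighted (w1 @ l # w2)" "excess (w1 @ l # w2) \<ge> 0"
      "fst (fst l) \<ge> 1" for w1 l w2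
    using that
  proof (induction w1 arbitrary: w2 rule: rev_induct)
    case Nil
    obtain i j Z where l: "l = ((i, j), Z)" by (metis prod.exhaust)
    have Z: "Z \<in> wt i j" "i \<ge> 1" and w2: "weighted w2" using Nil l by (auto simp: weighted_def)
    let ?u = "foldr \<rho> (map snd w2) v"
    have "\<rho> Z ?u - scM (\<xi> Z) ?u \<in> K" using K_generator wt_in_N Z by blast
    moreover have "scM (\<xi> Z) ?u - scM (scalar_part (l # w2)) (foldr \<rho> (operator_part (l # w2)) v) \<in> K"
    proof (cases "(i, j) = (1, 0)")
      case True
      then have "excess w2 \<ge> 0" using Nil l by (simp add: excess_def)
      then have "scM (\<xi> Z) (?u - scM (scalar_part w2) (foldr \<rho> (operator_part w2) v)) \<in> K"
        using less.hyps[OF _ w2] Nil(1) M.subspace_scale[OF subspace_K] by simp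
      then show ?thesis
        using True l by (simp add: scalar_part_def operator_part_def M.scale_right_diff_distrib)
    next
      case False
      then have "\<xi> Z = 0" "scalar_part (l # w2) = 0"
        using \<xi>_vanish Z l by (auto simp: scalar_part_def)
      then show ?thesis using M.subspace_0[OF subspace_K] by simp
    qed
    ultimately show ?case using M.subspace_add[OF subspace_K] l by fastforce
  next
    case (snoc m w1)
    obtain i j Z where l: "l = ((i, j), Z)" by (metis prod.exhaust)
    obtain i' j' W where m: "m = ((i', j'), W)" by (metis prod.exhaust)
    let ?c = "((i' + i, j' + j), br W Z)"
    let ?w = "w1 @ l # m # w2" and ?comm = "w1 @ ?c # w2" and ?orig = "(w1 @ [m]) @ l # w2"
    have "weighted ?w" "excess ?w \<ge> 0" "length ?w = length w"
      using snoc.prems by (auto simp: weighted_def excess_def)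
    then have 1: "foldr \<rho> (map snd ?w) v - scM (scalar_part ?w) (foldr \<rho> (operator_part ?w) v) \<in> K"
      using snoc.IH snoc.prems(4) by blast
    have "weighted ?comm" using snoc.prems(2) l m wt_bracket by (auto simp: weighted_def)
    moreover have ex: "excess ?comm > 0" using snoc.prems(3) l m by (auto simp: excess_def)
    moreover have "length ?comm < length w" using snoc.prems(1) by simp
    ultimately have "foldr \<rho> (map snd ?comm) v -
        scM (scalar_part ?comm) (foldr \<rho> (operator_part ?comm) v) \<in> K"
      using less.hyps[of ?comm] by simp
    moreover have "scalar_part ?comm = 0" using scalar_part_nonzero(3) ex by force
    ultimately have 2: "foldr \<rho> (map snd ?comm) v \<in> K" by simp
    have "foldr \<rho> (map snd ?orig) v = foldr \<rho> (map snd ?w) v + foldr \<rho> (map snd ?comm) v"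
      unfolding l m by (simp add: action_bracket flip: Act.word_add)
    moreover have "scalar_part ?orig = scalar_part ?w"
      by (simp add: scalar_part_def mult_ac)
    moreover have "operator_part ?orig = operator_part ?w"
      using snoc.prems(4) l by (simp add: operator_part_def)
    ultimately show ?case
      using M.subspace_add[OF subspace_K 1 2] by (simp add: algebra_simps)
  qed
  show ?case
  proof (cases "\<forall>l\<in>set w. fst (fst l) \<le> 0")
    case True
    then show ?thesis using word_mod_kernel_nonpositive less.prems by blast
  next
    case False
    then obtain w1 l w2 where w: "w = w1 @ l # w2" "fst (fst l) \<ge> 1"
      using split_list by (metis int_one_le_iff_zero_less not_le)
    then show ?thesis using front less.prems by blast
  qed
qed

section \<open>Weight components of a vanishing element\<close>

lemma word_weight:
  assumes "\<And>b. b \<in> B \<Longrightarrow> br H b = sc (of_int (h b)) b" "set bs \<subseteq> B"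
  shows "\<rho> H (foldr \<rho> bs v) - foldr \<rho> bs (\<rho> H v) = scM (of_int (\<Sum>b\<leftarrow>bs. h b)) (foldr \<rho> bs v)"
  using assms(2)
proof (induction bs)
  case (Cons b bs)
  let ?u = "foldr \<rho> bs v"
  have "\<rho> H (\<rho> b ?u) = \<rho> (br H b) ?u + \<rho> b (\<rho> H ?u)" by (simp add: action_bracket)
  also have "\<rho> H ?u = foldr \<rho> bs (\<rho> H v) + scM (of_int (\<Sum>b\<leftarrow>bs. h b)) ?u"
    using Cons by (simp add: algebra_simps)
  finally show ?case
    using Cons.prems assms(1)
    by (simp add: action_scale_left Act.op_add Act.op_scale M.scale_left_distrib)
qed simp

text \<open>The commutator with \<open>\<rho> H\<close> multiplies the operator of a word by its weight. Hence the sums over the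
  words of a given weight are eigencomponents of the zero operator.\<close>

lemma weight_component:
  assumes H: "\<And>b. b \<in> B \<Longrightarrow> br H b = sc (of_int (h b)) b"
    and fin: "finite W" and W: "\<And>bs. bs \<in> W \<Longrightarrow> set bs \<subseteq> B"
    and zero: "\<And>v. (\<Sum>bs\<in>W. scM (c bs) (foldr \<rho> bs v)) = 0"
  shows "(\<Sum>bs | bs \<in> W \<and> (\<Sum>b\<leftarrow>bs. h b) = q. scM (c bs) (foldr \<rho> bs v)) = 0"
proof -
  let ?wt = "\<lambda>bs. of_int (\<Sum>b\<leftarrow>bs. h b) :: complex"
  let ?z = "\<lambda>l v. \<Sum>bs | bs \<in> W \<and> ?wt bs = l. scM (c bs) (foldr \<rho> bs v)"
  let ?T = "\<lambda>A v. \<rho> H (A v) - A (\<rho> H v)"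
  interpret Op: vector_space "\<lambda>c A v. scM c (A v) :: 'm"
    by unfold_locales (auto simp: fun_eq_iff M.scale_right_distrib M.scale_left_distrib)
  have app: "(\<Sum>l\<in>S. f l) v = (\<Sum>l\<in>S. f l v)" for f :: "complex \<Rightarrow> 'm \<Rightarrow> 'm" and S v
    by (induction S rule: infinite_finite_induct) auto
  have z0: "?z l = 0" if "l \<in> ?wt ` W" for l
  proof (rule Op.eigencomponents_zero[of ?T "?wt ` W" ?z l])
    show "finite (?wt ` W)" using fin by simp
    show "?T (\<lambda>v. ?z l v) = (\<lambda>v. scM l (?z l v))" for l
    proof
      fix v
      have "?T (?z l) v = (\<Sum>bs | bs \<in> W \<and> ?wt bs = l.
          scM (c bs) (\<rho> H (foldr \<rho> bs v) - foldr \<rho> bs (\<rho> H v)))"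
        by (simp add: Act.op_sum Act.op_scale sum_subtractf M.scale_right_diff_distrib)
      also have "\<dots> = (\<Sum>bs | bs \<in> W \<and> ?wt bs = l. scM l (scM (c bs) (foldr \<rho> bs v)))"
        using word_weight[where h = h, OF H W] by (intro sum.cong refl) (auto simp: mult.commute)
      finally show "?T (?z l) v = scM l (?z l v)" by (simp add: M.scale_sum_right)
    qed
    show "(\<Sum>l\<in>?wt ` W. ?z l) = 0"
    proof
      fix v
      have "(\<Sum>l\<in>?wt ` W. ?z l) v = (\<Sum>l\<in>?wt ` W. ?z l v)" by (rule app)
      also have "\<dots> = (\<Sum>bs\<in>W. scM (c bs) (foldr \<rho> bs v))"
        by (rule sum.image_gen[OF fin, symmetric])
      finally show "(\<Sum>l\<in>?wt ` W. ?z l) v = 0 v" using zero by simp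
    qed
  qed (use that in \<open>auto simp: fun_eq_iff Act.op_add Act.op_scale M.scale_right_diff_distrib\<close>)
  show ?thesis
  proof (cases "of_int q \<in> ?wt ` W")
    case True
    show ?thesis using fun_cong[OF z0[OF True], of v] by (simp only: of_int_eq_iff zero_fun_apply)
  next
    case False
    then show ?thesis by (intro sum.neutral) auto
  qed
qed

end

section \<open>From the annihilator of the graded coinvariants to the annihilator variety\<close>

context coinvariant_setting
begin

lemma filtered_quotient_coinvariants:
  assumes F: "module_filtration sc br scM \<rho> F"
  shows "filtered_quotient sc br scM \<rho> G K F"
proof
  fix Z v i assume v: "v \<in> F i"
  have "env_class sc br (gen Z) \<in> env_filtration sc br 1" by (auto simp: env_filtration_def)
  then have "env_act scM \<rho> (env_class sc br (gen Z)) v \<in> F (1 + i)"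
    using F v unfolding module_filtration_def by blast
  then show "\<rho> Z v \<in> F (Suc i)" by (simp add: env_act_class)
qed (use F subspace_G subspace_K stable_K in \<open>auto simp: module_filtration_def\<close>)

lemma homogeneous_vanishes:
  assumes F: "module_filtration sc br scM \<rho> F"
    and \<psi>: "\<psi> \<in> associated_variety sc G (coinvariants scM \<rho> N \<xi>) (coinv_filtration scM \<rho> N \<xi> F)
      (coinv_act scM \<rho> N \<xi>)"
    and P: "P \<in> carrier (free_ring G)" "\<And>w. w \<in> Poly_Mapping.keys P \<Longrightarrow> length (letters w) = n"
      "\<And>v. poly_act scM \<rho> P v \<in> K"
  shows "free_eval \<psi> P = 0"
proof -
  interpret Gr: filtered_quotient sc br scM \<rho> G K F by (rule filtered_quotient_coinvariants[OF F])
  have "Gr.quot = coinvariants scM \<rho> N \<xi>" by (simp add: Gr.quot_def coinvariants_def)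
  moreover have "Gr.quot_filtration = coinv_filtration scM \<rho> N \<xi> F"
    by (simp add: fun_eq_iff Gr.quot_filtration_def coinv_filtration_def Gr.cls_def[abs_def])
  moreover have "Gr.quot_act = coinv_act scM \<rho> N \<xi>"
    by (simp add: fun_eq_iff Gr.quot_act_def coinv_act_def)
  ultimately have "sym_eval \<psi> (sym_class sc G P) = 0" and "\<psi> \<in> dual_space sc G"
    using \<psi> Gr.homogeneous_in_annihilator[OF P] by (auto simp: associated_variety_def zero_set_def)
  then show ?thesis by (simp add: Gr.sym_eval_class)
qed

definition tagged :: "'a list \<Rightarrow> ((int \<times> int) \<times> 'a) list"
  where "tagged bs = map (\<lambda>b. ((wx b, wy b), b)) bs"

lemma tagged_simps [simp]:
  "map snd (tagged bs) = bs"
  "(\<Sum>l\<leftarrow>tagged bs. fst (fst l)) = (\<Sum>b\<leftarrow>bs. wx b)"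
  "(\<Sum>l\<leftarrow>tagged bs. snd (fst l)) = (\<Sum>b\<leftarrow>bs. wy b)"
  "length (tagged bs) = length bs"
  by (auto simp: tagged_def comp_def)

lemma weighted_tagged: "set bs \<subseteq> B \<Longrightarrow> weighted (tagged bs)"
  using wt_B by (auto simp: weighted_def tagged_def)

lemma excess_tagged: "excess (tagged bs) = (\<Sum>b\<leftarrow>bs. wx b) + (\<Sum>b\<leftarrow>bs. wy b) - int (length bs)"
  by (induction bs) (auto simp: excess_def tagged_def)

lemma operator_part_tagged: "set bs \<subseteq> B \<Longrightarrow> set (operator_part (tagged bs)) \<subseteq> wt 0 1"
  using wt_B by (fastforce simp: operator_part_def tagged_def)

text \<open>In the proof, \<open>W\<close> is the set of all words in the weight basis of length at most \<open>k\<close>, \<open>c\<close> gives the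
  coordinates of \<open>t + r\<close>, \<open>S p\<close> contains the words of total weight \<open>(k - p, p)\<close>, and \<open>P p\<close> is the homogeneous
  polynomial through which their combination acts on the coinvariants. The words in \<open>A\<close> are those
  that contribute to the value of \<open>t\<close> at \<open>f\<close>.\<close>

theorem glued_in_annihilator_variety:
  assumes F: "module_filtration sc br scM \<rho> F"
    and \<psi>: "\<psi> \<in> associated_variety sc G (coinvariants scM \<rho> N \<xi>) (coinv_filtration scM \<rho> N \<xi> F)
      (coinv_act scM \<rho> N \<xi>)"
  shows "glued_functional sc br X Y (restrict \<psi> (wt 0 1)) \<xi> \<in> annihilator_variety sc br scM \<rho>"
proof -
  define f where "f = glued_functional sc br X Y (restrict \<psi> (wt 0 1)) \<xi>"
  have "\<psi> \<in> dual_space sc G" using \<psi> by (simp add: associated_variety_def zero_set_def)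
  then have "restrict \<psi> (wt 0 1) \<in> dual_space sc (wt 0 1)"
    using wt01_in_G subspace_add[OF subspace_wt] subspace_scale[OF subspace_wt]
    by (auto simp: dual_space_def subset_iff)
  note glued = glued_functional_correct[OF this \<xi>_dual subspace_N wt_in_N[OF order_refl], folded f_def]
  have f_word: "(\<Prod>b\<leftarrow>bs. f b) =
      scalar_part (tagged bs) * (\<Prod>b\<leftarrow>operator_part (tagged bs). \<psi> b)" if "set bs \<subseteq> B" for bs
    using that
  proof (induction bs)
    case (Cons b bs)
    have "f b = (if wx b = 0 \<and> wy b = 1 then \<psi> b else if wx b = 1 \<and> wy b = 0 then \<xi> b else 0)"
      using glued(2)[of b] glued(3)[of b] glued(4)[of "wx b" "wy b" b] wt_B[of b] Cons.prems by auto
    with Cons show ?case by (auto simp: scalar_part_def operator_part_def tagged_def)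
  qed (simp add: scalar_part_def operator_part_def tagged_def)
  have "free_eval f t = 0"
    if t: "\<forall>w\<in>Poly_Mapping.keys t. length (letters w) = k"
      and r: "\<forall>w\<in>Poly_Mapping.keys r. length (letters w) < k"
      and kills: "\<And>v. poly_act scM \<rho> (t + r) v = 0" for k t r
  proof -
    define W where "W = (\<Union>n\<le>k. basis_words n)"
    define c where "c bs = poly_coord t bs + poly_coord r bs" for bs
    have finW: "finite W" by (simp add: W_def)
    have W_B: "set bs \<subseteq> B" and W_length: "length bs \<le> k" if "bs \<in> W" for bs
      using that by (auto simp: W_def basis_words_def)
    \<comment> \<open>The parts \<open>t\<close> and \<open>r\<close> have no word length in common.\<close>
    have coords: "poly_coord t bs = (if length bs = k then c bs else 0)" for bs
    proof (cases "length bs = k")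
      case True
      then have none: "{w \<in> Poly_Mapping.keys r. length (letters w) = length bs} = {}" using r by auto
      have "poly_coord r bs = 0" unfolding poly_coord_def none by simp
      then show ?thesis using True by (simp add: c_def)
    next
      case False
      then have none: "{w \<in> Poly_Mapping.keys t. length (letters w) = length bs} = {}" using t by auto
      have "poly_coord t bs = 0" unfolding poly_coord_def none by simp
      then show ?thesis using False by simp
    qed
    have zero: "(\<Sum>bs\<in>W. scM (c bs) (foldr \<rho> bs v)) = 0" for v
    proof -
      have left: "\<rho> Z v = (\<Sum>b\<in>B. scM (coord Z b) (\<rho> b v))" for Z v
      proof -
        have z: "\<rho> 0 v = 0" using action_add_left[of 0 0 v] by simp
        have "\<rho> (\<Sum>b\<in>A. sc (coord Z b) b) v = (\<Sum>b\<in>A. scM (coord Z b) (\<rho> b v))" for A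
          by (induction A rule: infinite_finite_induct) (auto simp: z action_add_left action_scale_left)
        then show ?thesis by (metis coord_sum)
      qed
      have "0 = poly_act scM \<rho> t v + poly_act scM \<rho> r v" using kills[of v] by (simp add: Act.act_add)
      also have "poly_act scM \<rho> t v = (\<Sum>bs\<in>W. scM (poly_coord t bs) (foldr \<rho> bs v))"
        unfolding W_def using t by (intro poly_expansion operator_family_action left) auto
      also have "poly_act scM \<rho> r v = (\<Sum>bs\<in>W. scM (poly_coord r bs) (foldr \<rho> bs v))"
        unfolding W_def using r by (intro poly_expansion operator_family_action left) auto
      finally show ?thesis by (simp add: c_def M.scale_left_distrib sum.distrib)
    qed
    define S where "S p = {bs \<in> W. (\<Sum>b\<leftarrow>bs. wx b) = int k - int p \<and> (\<Sum>b\<leftarrow>bs. wy b) = int p}" for p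
    have S_zero: "(\<Sum>bs\<in>S p. scM (c bs) (foldr \<rho> bs v)) = 0" for p v
    proof -
      have HX: "br X b = sc (of_int (wx b)) b" and HY: "br Y b = sc (of_int (wy b)) b" if "b \<in> B" for b
        using wt_B[OF that] by (simp_all add: weight_space_def)
      let ?WX = "{bs \<in> W. (\<Sum>b\<leftarrow>bs. wx b) = int k - int p}"
      have "(\<Sum>bs\<in>?WX. scM (c bs) (foldr \<rho> bs v)) = 0" for v
        by (rule weight_component[OF HX finW W_B zero])
      then have "(\<Sum>bs | bs \<in> ?WX \<and> (\<Sum>b\<leftarrow>bs. wy b) = int p. scM (c bs) (foldr \<rho> bs v)) = 0"
        by (intro weight_component[OF HY]) (use finW W_B in auto)
      then show ?thesis by (simp add: S_def conj_assoc)
    qed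
    define P where "P p = (\<Sum>bs\<in>S p. Poly_Mapping.single (Word (operator_part (tagged bs)))
      (c bs * scalar_part (tagged bs)))" for p
    have S_B: "set bs \<subseteq> B" if "bs \<in> S p" for bs p using that W_B by (auto simp: S_def)
    have P_carrier: "P p \<in> carrier (free_ring G)" for p
      unfolding P_def using operator_part_tagged[OF S_B] wt01_in_G
      by (intro sum_in_free_ring single_in_free_ring) blast
    have P_deg: "length (letters w) = p" if w: "w \<in> Poly_Mapping.keys (P p)" for w p
    proof -
      have "Poly_Mapping.keys (P p) \<subseteq> (\<Union>bs\<in>S p. Poly_Mapping.keys
          (Poly_Mapping.single (Word (operator_part (tagged bs))) (c bs * scalar_part (tagged bs))))"
        unfolding P_def by (rule Poly_Mapping.keys_sum)
      then obtain bs where "bs \<in> S p" and "w \<in> Poly_Mapping.keys (Poly_Mapping.single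
          (Word (operator_part (tagged bs))) (c bs * scalar_part (tagged bs)))"
        using w by blast
      then have bs: "bs \<in> S p" "w = Word (operator_part (tagged bs))" "scalar_part (tagged bs) \<noteq> 0"
        by (auto split: if_splits)
      then show ?thesis using scalar_part_nonzero(1)[OF bs(3)] by (simp add: S_def)
    qed
    have P_act: "poly_act scM \<rho> (P p) v \<in> K" for p v
    proof -
      let ?d = "\<lambda>bs. foldr \<rho> bs v -
        scM (scalar_part (tagged bs)) (foldr \<rho> (operator_part (tagged bs)) v)"
      have "?d bs \<in> K" if bs: "bs \<in> S p" for bs
      proof -
        \<comment> \<open>The weight is \<open>(k - p, p)\<close> and the length is at most \<open>k\<close>.\<close>
        have "excess (tagged bs) \<ge> 0" using bs W_length by (auto simp: S_def excess_tagged)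
        then show ?thesis using word_mod_kernel[OF weighted_tagged[OF S_B[OF bs]]] by simp
      qed
      then have "- (\<Sum>bs\<in>S p. scM (c bs) (?d bs)) \<in> K"
        by (intro M.subspace_neg[OF subspace_K] M.subspace_sum[OF subspace_K]
            M.subspace_scale[OF subspace_K])
      also have "- (\<Sum>bs\<in>S p. scM (c bs) (?d bs)) = poly_act scM \<rho> (P p) v"
        by (simp add: M.scale_right_diff_distrib sum_subtractf S_zero P_def Act.act_sum)
      finally show ?thesis .
    qed
    let ?g = "\<lambda>bs. c bs * (\<Prod>b\<leftarrow>bs. f b)"
    have P_eval: "(\<Sum>bs\<in>S p. ?g bs) = 0" for p
    proof -
      have "free_eval \<psi> (P p) = (\<Sum>bs\<in>S p. ?g bs)"
        unfolding P_def free_eval_sum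
        using f_word[OF S_B] by (intro sum.cong refl) (simp add: free_eval_single mult_ac)
      then show ?thesis using homogeneous_vanishes[OF F \<psi> P_carrier P_deg P_act] by simp
    qed
    define A where "A = {bs \<in> W. length bs = k \<and> scalar_part (tagged bs) \<noteq> 0}"
    have A_weights: "(\<Sum>b\<leftarrow>bs. wy b) = int (length (operator_part (tagged bs)))"
      "(\<Sum>b\<leftarrow>bs. wx b) = int (length bs) - int (length (operator_part (tagged bs)))"
      if "scalar_part (tagged bs) \<noteq> 0" for bs
      using scalar_part_nonzero(1,2)[OF that] by simp_all
    have "free_eval f t = (\<Sum>bs\<in>W. poly_coord t bs * (\<Prod>b\<leftarrow>bs. f b))"
    proof -
      have f: "f Z * v = (\<Sum>b\<in>B. coord Z b * (f b * v))" for Z v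
      proof -
        have "f Z = (\<Sum>b\<in>B. coord Z b * f b)"
          using dual_space_sum[OF vector_space_axioms glued(1) subspace_UNIV, of B "\<lambda>b. b" "coord Z"]
          unfolding coord_sum by simp
        then have "f Z * v = (\<Sum>b\<in>B. coord Z b * f b) * v" by (rule arg_cong)
        then show ?thesis by (simp only: sum_distrib_right mult.assoc)
      qed
      have word: "foldr (\<lambda>x. (*) (f x)) bs 1 = (\<Prod>b\<leftarrow>bs. f b)" for bs by (induction bs) auto
      have "poly_act (*) (\<lambda>x. (*) (f x)) t 1 =
          (\<Sum>bs\<in>W. poly_coord t bs * foldr (\<lambda>x. (*) (f x)) bs 1)"
        unfolding W_def using t by (intro poly_expansion operator_family_mult f) auto
      then show ?thesis unfolding free_eval_poly_act word .
    qed
    also have "\<dots> = (\<Sum>bs\<in>A. ?g bs)"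
      unfolding A_def using finW
      by (intro sum.mono_neutral_cong_right) (auto simp: coords f_word W_B)
    also have "\<dots> = (\<Sum>p\<le>k. \<Sum>bs | bs \<in> A \<and> length (operator_part (tagged bs)) = p. ?g bs)"
    proof -
      have "length (operator_part (tagged bs)) \<le> k" if "bs \<in> A" for bs
        using that length_filter_le[of "\<lambda>l. fst l = (0, 1)" "tagged bs"]
        by (simp add: A_def operator_part_def)
      then have "(\<lambda>bs. length (operator_part (tagged bs))) ` A \<subseteq> {..k}" by auto
      moreover have "finite A" using finW by (simp add: A_def)
      ultimately show ?thesis by (intro sum.group[symmetric]) auto
    qed
    also have "\<dots> = (\<Sum>p\<le>k. \<Sum>bs\<in>S p. ?g bs)"
    proof (rule sum.cong[OF refl], rule sum.mono_neutral_left)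
      fix p
      show "finite (S p)" using finW by (simp add: S_def)
      show "{bs \<in> A. length (operator_part (tagged bs)) = p} \<subseteq> S p"
        by (auto simp: A_def S_def A_weights)
      show "\<forall>bs\<in>S p - {bs \<in> A. length (operator_part (tagged bs)) = p}. ?g bs = 0"
      proof
        fix bs assume bs: "bs \<in> S p - {bs \<in> A. length (operator_part (tagged bs)) = p}"
        \<comment> \<open>A word in \<open>S p\<close> with nonzero scalar part has excess zero, that is, length \<open>k\<close>, and \<open>p\<close> letters of weight \<open>(0,1)\<close>.\<close>
        have "scalar_part (tagged bs) = 0"
        proof (rule ccontr)
          assume nz: "scalar_part (tagged bs) \<noteq> 0"
          then have "length (operator_part (tagged bs)) = p" "length bs = k"
            using bs A_weights[OF nz] by (auto simp: S_def)
          then show False using bs nz by (auto simp: A_def S_def)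
        qed
        then show "?g bs = 0" using f_word S_B bs by auto
      qed
    qed
    also have "\<dots> = 0" using P_eval by simp
    finally show ?thesis .
  qed
  then show ?thesis
    unfolding f_def[symmetric] using glued(1) by (intro in_annihilator_varietyI) blast+
qed

end

theorem lemma5p5p3:
  fixes sc :: "complex \<Rightarrow> 'a::ab_group_add \<Rightarrow> 'a"
    and br :: "'a \<Rightarrow> 'a \<Rightarrow> 'a"
    and X Y :: 'a
    and \<xi> \<phi> :: "'a \<Rightarrow> complex"
    and scM :: "complex \<Rightarrow> 'm::ab_group_add \<Rightarrow> 'm"
    and \<rho> :: "'a \<Rightarrow> 'm \<Rightarrow> 'm"
    and F :: "nat \<Rightarrow> 'm set"
  assumes "complex_lie_algebra sc br"
    and "br X Y = 0"
    and "ad_semisimple sc br X" and "integer_ad_eigenvalues sc br X"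
    and "ad_semisimple sc br Y" and "integer_ad_eigenvalues sc br Y"
    and "\<And>i j. j \<notin> {-1, 0, 1} \<Longrightarrow> weight_space sc br X Y i j = {0}"
    and "weight_space sc br X Y 1 (-1) = {0}"
    and "\<xi> \<in> dual_space sc (upper_part sc br X Y 1)"
    and "\<And>Z. Z \<in> upper_part sc br X Y 2 \<Longrightarrow> \<xi> Z = 0"
    and "\<And>i j Z. i \<ge> 1 \<Longrightarrow> (i, j) \<noteq> (1, 0) \<Longrightarrow> Z \<in> weight_space sc br X Y i j \<Longrightarrow> \<xi> Z = 0"
    and "lie_module sc br scM \<rho>"
    and "module_filtration sc br scM \<rho> F"
    and "\<phi> \<in> (\<lambda>\<psi>. restrict \<psi> (weight_space sc br X Y 0 1)) `
      associated_variety sc (stabilizer0 sc br X Y \<xi>)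
        (coinvariants scM \<rho> (upper_part sc br X Y 1) \<xi>)
        (coinv_filtration scM \<rho> (upper_part sc br X Y 1) \<xi> F)
        (coinv_act scM \<rho> (upper_part sc br X Y 1) \<xi>)"
  shows "glued_functional sc br X Y \<phi> \<xi> \<in> annihilator_variety sc br scM \<rho>"
proof -
  have "bigraded_lie_algebra sc br X Y"
    using assms(1-6) by (simp add: bigraded_lie_algebra_def bigraded_lie_algebra_axioms_def)
  then obtain B wx wy where "weight_basis sc br X Y B wx wy"
    by (rule bigraded_lie_algebra.weight_basis_exists)
  then have "coinvariant_setting sc br X Y B wx wy scM \<rho> \<xi>"
    using assms(7-9,11,12)
    by (intro coinvariant_setting.intro coinvariant_setting_axioms.intro)
  then show ?thesis
    using coinvariant_setting.glued_in_annihilator_variety assms(13,14) by blast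
qed

end
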